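(* Let $m$ be an odd natural number and let $h$ be a small positive parameter (i.e. the assertion is for all sufficiently small $h>0$, depending on $m$). Let $$G_m(h\beta)=\frac{\operatorname{sgn}(h\beta)}{2m}\left(\sinh(h\beta)+\sum_{n=1}^{m-1}e^{h\beta\cos\frac{\pi n}{m}}\cos\left(h\beta\sin\frac{\pi n}{m}+\frac{\pi n}{m}\right)\right),\qquad \beta\in\mathbb Z.$$ Then the discrete analogue $D_m(h\beta)$, $\beta\in\mathbb{Z}$, of the differential operator $\frac{d^{2m}}{dx^{2m}}-1$, satisfying the equation $$D_m(h\beta)*G_m(h\beta)=\delta_{\mathrm d}(h\beta)\qquad\text{for all }\beta\in\mathbb Z,$$ has the form (that is, the function $D_m$ given by the following formula satisfies this equation) $$D_m(h\beta)=\frac{m}{K}\begin{cases}\displaystyle\sum_{n=1}^{m-1}A_n\lambda_n^{|\beta|-1}, & |\beta|\ge 2,\\[2mm] \displaystyle 1+\sum_{n=1}^{m-1}A_n, & |\beta|=1,\\[2mm] \displaystyle M_1-\frac{K_1}{K}+\sum_{n=1}^{m-1}\frac{A_n}{\lambda_n}, & \beta=0,\end{cases}$$ where $$A_n=\frac{(\lambda_n^2-2\lambda_n\cosh(h)+1)\,B_{2m-2}(\lambda_n)}{\lambda_n\,\mathcal P_{2m-2}'(\lambda_n)},\quad n=1,\dots,m-1,$$ $$K=\sinh(h)+\sum_{k=1}^{\frac{m-1}{2}}a_{1,k},\qquad M_1=\sum_{k=1}^{\frac{m-1}{2}}b_{1,k}-2\cosh(h),$$ $$K_1=\sum_{k=1}^{\frac{m-1}{2}}\left(b_{1,k}\sinh(h)+a_{2,k}+a_{1,k}\left(\sum_{j=1,\,j\ne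 k}^{\frac{m-1}{2}}b_{1,j}-2\cosh(h)\right)\right),$$ $$B_{2m-2}(\lambda)=\prod_{k=1}^{\frac{m-1}{2}}\left(\lambda^4+b_{1,k}\lambda^3+b_{2,k}\lambda^2+b_{1,k}\lambda+1\right),$$ $$\mathcal P_{2m-2}(\lambda)=\frac1K\left(\sinh(h)+(\lambda^2-2\lambda\cosh(h)+1)\sum_{j=1}^{\frac{m-1}{2}}\frac{a_{1,j}\lambda^2+a_{2,j}\lambda+a_{1,j}}{\lambda^4+b_{1,j}\lambda^3+b_{2,j}\lambda^2+b_{1,j}\lambda+1}\right)B_{2m-2}(\lambda),$$ and, for $k=1,2,\dots,\frac{m-1}{2}$, $$a_{1,k}=2\left[\cos\frac{\pi k}{m}\cos\left(h\sin\frac{\pi k}{m}\right)\sinh\left(h\cos\frac{\pi k}{m}\right)-\sin\frac{\pi k}{m}\sin\left(h\sin\frac{\pi k}{m}\right)\cosh\left(h\cos\frac{\pi k}{m}\right)\right],$$ $$a_{2,k}=-2\left[\cos\frac{\pi k}{m}\sinh\left(2h\cos\frac{\pi k}{m}\right)-\sin\frac{\pi k}{m}\sin\left(2h\sin\frac{\pi k}{m}\right)\right],$$ $$b_{1,k}=-4\cos\left(h\sin\frac{\pi k}{m}\right)\cosh\left(h\cos\frac{\pi k}{m}\right),$$ $$b_{2,k}=2\left[1+\cos\left(2h\sin\frac{\pi k}{m}\right)+\cosh\left(2h\cos\frac{\pi k}{m}\right)\right],$$ and $\lambda_1,\dots,\lambda_{m-1}$ are the roots of the polynomial $\mathcal P_{2m-2}(\lambda)$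 with $|\lambda_n|<1$.
   Context: Functions of discrete argument are functions defined on the grid $\{h\beta:\beta\in\mathbb Z\}$. The convolution of two such functions is $$\varphi(h\beta)*\psi(h\beta)=\sum_{\gamma=-\infty}^{\infty}\varphi(h\gamma)\,\psi(h\beta-h\gamma).$$ The discrete delta-function is $\delta_{\mathrm d}(h\beta)=1$ if $\beta=0$ and $\delta_{\mathrm d}(h\beta)=0$ if $\beta\neq0$. The function $G_m(x)$ (given by the formula for $G_m(h\beta)$ with $h\beta$ replaced by $x\in\mathbb R$) satisfies $\left(\frac{d^{2m}}{dx^{2m}}-1\right)G_m(x)=\delta(x)$ with $\delta$ Dirac's delta-function; a function $D_m$ of discrete argument with $D_m(h\beta)*G_m(h\beta)=\delta_{\mathrm d}(h\beta)$ is called a discrete analogue of the operator $\frac{d^{2m}}{dx^{2m}}-1$. Empty sums equal $0$ and empty products equal $1$ (relevant for $m=1$). *)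

theory Defs
  imports "HOL-Analysis.Analysis" "HOL-Computational_Algebra.Polynomial"
begin

text \<open>
  A function of discrete argument on the grid \<open>{h\<beta> : \<beta> \<in> \<int>}\<close>, for \<open>h > 0\<close>, is represented by the
  function \<open>int \<Rightarrow> complex\<close> that sends \<open>\<beta>\<close> to its value at \<open>h\<beta>\<close>. Values are complex because the
  roots \<open>\<lambda>\<^sub>n\<close> of \<open>P_poly\<close> are a priori complex.
\<close>

definition discrete_conv :: "(int \<Rightarrow> complex) \<Rightarrow> (int \<Rightarrow> complex) \<Rightarrow> int \<Rightarrow> complex" where
  "discrete_conv \<phi> \<psi> \<beta> = (\<Sum>\<^sub>\<infinity>\<gamma>. \<phi> \<gamma> * \<psi> (\<beta> - \<gamma>))"

definition discrete_delta :: "int \<Rightarrow> complex" where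
  "discrete_delta \<beta> = (if \<beta> = 0 then 1 else 0)"

definition G_fun :: "nat \<Rightarrow> real \<Rightarrow> real" where
  "G_fun m x = sgn x / (2 * real m) *
     (sinh x + (\<Sum>n=1..m-1. exp (x * cos (pi * real n / real m)) *
        cos (x * sin (pi * real n / real m) + pi * real n / real m)))"

definition G_grid :: "nat \<Rightarrow> real \<Rightarrow> int \<Rightarrow> complex" where
  "G_grid m h \<beta> = complex_of_real (G_fun m (h * real_of_int \<beta>))"

text \<open>
  Since \<^const>\<open>infsum\<close> is \<open>0\<close> on families that are not summable, convergence of the series defining
  the convolution is required explicitly.
\<close>

definition is_discrete_analogue :: "nat \<Rightarrow> real \<Rightarrow> (int \<Rightarrow> complex) \<Rightarrow> bool" where
  "is_discrete_analogue m h D \<longleftrightarrow>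
     (\<forall>\<beta>. (\<lambda>\<gamma>. D \<gamma> * G_grid m h (\<beta> - \<gamma>)) summable_on UNIV \<and>
          discrete_conv D (G_grid m h) \<beta> = discrete_delta \<beta>)"

definition a1 :: "nat \<Rightarrow> real \<Rightarrow> nat \<Rightarrow> real" where
  "a1 m h k = 2 *
     (cos (pi * real k / real m) * cos (h * sin (pi * real k / real m)) *
        sinh (h * cos (pi * real k / real m))
      - sin (pi * real k / real m) * sin (h * sin (pi * real k / real m)) *
        cosh (h * cos (pi * real k / real m)))"

definition a2 :: "nat \<Rightarrow> real \<Rightarrow> nat \<Rightarrow> real" where
  "a2 m h k = - 2 *
     (cos (pi * real k / real m) * sinh (2 * h * cos (pi * real k / real m))
      - sin (pi * real k / real m) * sin (2 * h * sin (pi * real k / real m)))"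

definition b1 :: "nat \<Rightarrow> real \<Rightarrow> nat \<Rightarrow> real" where
  "b1 m h k = - 4 * cos (h * sin (pi * real k / real m)) * cosh (h * cos (pi * real k / real m))"

definition b2 :: "nat \<Rightarrow> real \<Rightarrow> nat \<Rightarrow> real" where
  "b2 m h k = 2 * (1 + cos (2 * h * sin (pi * real k / real m))
                     + cosh (2 * h * cos (pi * real k / real m)))"

definition K :: "nat \<Rightarrow> real \<Rightarrow> real" where
  "K m h = sinh h + (\<Sum>k=1..(m-1) div 2. a1 m h k)"

definition M1 :: "nat \<Rightarrow> real \<Rightarrow> real" where
  "M1 m h = (\<Sum>k=1..(m-1) div 2. b1 m h k) - 2 * cosh h"

definition K1 :: "nat \<Rightarrow> real \<Rightarrow> real" where
  "K1 m h = (\<Sum>k=1..(m-1) div 2. b1 m h k * sinh h + a2 m h k +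
     a1 m h k * ((\<Sum>j\<in>{1..(m-1) div 2} - {k}. b1 m h j) - 2 * cosh h))"

definition quartic :: "nat \<Rightarrow> real \<Rightarrow> nat \<Rightarrow> complex poly" where
  "quartic m h k = [:1, of_real (b1 m h k), of_real (b2 m h k), of_real (b1 m h k), 1:]"

definition B_poly :: "nat \<Rightarrow> real \<Rightarrow> complex poly" where
  "B_poly m h = (\<Prod>k=1..(m-1) div 2. quartic m h k)"

text \<open>
  The \<open>j\<close>-th summand of the fraction sum is multiplied by \<open>B_poly m h\<close>, which cancels the
  denominator \<open>quartic m h j\<close> and leaves the product over the indices \<open>k \<noteq> j\<close>.
  Lemma \<open>poly_P_poly\<close> below gives the uncancelled form.
\<close>

definition P_poly :: "nat \<Rightarrow> real \<Rightarrow> complex poly" where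
  "P_poly m h = smult (of_real (1 / K m h))
     (smult (of_real (sinh h)) (B_poly m h) +
      [:1, of_real (- 2 * cosh h), 1:] *
      (\<Sum>j=1..(m-1) div 2. [:of_real (a1 m h j), of_real (a2 m h j), of_real (a1 m h j):] *
         (\<Prod>k\<in>{1..(m-1) div 2} - {j}. quartic m h k)))"

lemma poly_P_poly:
  assumes "\<And>j. j \<in> {1..(m-1) div 2} \<Longrightarrow> poly (quartic m h j) z \<noteq> 0"
  shows "poly (P_poly m h) z = 1 / of_real (K m h) *
     (of_real (sinh h) + (z^2 - 2 * z * of_real (cosh h) + 1) *
        (\<Sum>j=1..(m-1) div 2. (of_real (a1 m h j) * z^2 + of_real (a2 m h j) * z + of_real (a1 m h j)) /
           (z^4 + of_real (b1 m h j) * z^3 + of_real (b2 m h j) * z^2 + of_real (b1 m h j) * z + 1)))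
     * poly (B_poly m h) z"
proof -
  let ?J = "{1..(m-1) div 2}"
  have q: "z^4 + of_real (b1 m h j) * z^3 + of_real (b2 m h j) * z^2 + of_real (b1 m h j) * z + 1
      = poly (quartic m h j) z" for j
    by (simp add: quartic_def algebra_simps power2_eq_square power3_eq_cube power4_eq_xxxx)
  have num: "of_real (a1 m h j) * z^2 + of_real (a2 m h j) * z + of_real (a1 m h j)
      = poly [:of_real (a1 m h j), of_real (a2 m h j), of_real (a1 m h j):] z" for j
    by (simp add: algebra_simps power2_eq_square)
  have c: "z^2 - 2 * z * of_real (cosh h) + 1 = poly [:1, of_real (- 2 * cosh h), 1:] z"
    by (simp add: algebra_simps power2_eq_square)
  have B: "poly (B_poly m h) z =
      poly (quartic m h j) z * (\<Prod>k\<in>?J - {j}. poly (quartic m h k) z)" if "j \<in> ?J" for j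
    using that unfolding B_poly_def poly_prod by (intro prod.remove) auto
  have "(\<Sum>j\<in>?J. poly [:of_real (a1 m h j), of_real (a2 m h j), of_real (a1 m h j):] z
           / poly (quartic m h j) z) * poly (B_poly m h) z
      = (\<Sum>j\<in>?J. poly [:of_real (a1 m h j), of_real (a2 m h j), of_real (a1 m h j):] z
           * (\<Prod>k\<in>?J - {j}. poly (quartic m h k) z))"
    unfolding sum_distrib_right
  proof (rule sum.cong[OF refl])
    fix j assume j: "j \<in> ?J"
    show "poly [:of_real (a1 m h j), of_real (a2 m h j), of_real (a1 m h j):] z
           / poly (quartic m h j) z * poly (B_poly m h) z
        = poly [:of_real (a1 m h j), of_real (a2 m h j), of_real (a1 m h j):] z
           * (\<Prod>k\<in>?J - {j}. poly (quartic m h k) z)"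
      unfolding B[OF j] using assms[OF j] by simp
  qed
  then show ?thesis
    unfolding P_poly_def q num c
    by (simp only: poly_smult poly_add poly_mult poly_sum poly_prod distrib_right mult.assoc
        of_real_divide of_real_1)
qed

definition A_coeff :: "nat \<Rightarrow> real \<Rightarrow> complex \<Rightarrow> complex" where
  "A_coeff m h z = (z^2 - 2 * z * of_real (cosh h) + 1) * poly (B_poly m h) z /
     (z * poly (pderiv (P_poly m h)) z)"

text \<open>The roots are complex and pairwise distinct, and there are exactly \<open>m - 1\<close> of them.\<close>

definition enumerates_inner_roots :: "nat \<Rightarrow> real \<Rightarrow> (nat \<Rightarrow> complex) \<Rightarrow> bool" where
  "enumerates_inner_roots m h lam \<longleftrightarrow>
     bij_betw lam {1..m-1} {z. poly (P_poly m h) z = 0 \<and> cmod z < 1}"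

definition D_grid :: "nat \<Rightarrow> real \<Rightarrow> (nat \<Rightarrow> complex) \<Rightarrow> int \<Rightarrow> complex" where
  "D_grid m h lam \<beta> = of_real (real m / K m h) *
     (if \<beta> = 0 then
        of_real (M1 m h - K1 m h / K m h) + (\<Sum>n=1..m-1. A_coeff m h (lam n) / lam n)
      else if \<bar>\<beta>\<bar> = 1 then
        1 + (\<Sum>n=1..m-1. A_coeff m h (lam n))
      else
        (\<Sum>n=1..m-1. A_coeff m h (lam n) * lam n ^ (nat \<bar>\<beta>\<bar> - 1)))"

end

theory Submission
  imports Defs
begin

text \<open>
  Everything in sight is invariant under \<open>z \<mapsto> 1/z\<close>, and the proof works in the variable
  \<open>w = z + 1/z\<close>. Put \<open>\<omega>\<^sub>n = exp (\<i>\<pi>n/m)\<close>, \<open>C\<^sub>n = cosh (h\<omega>\<^sub>n)\<close> and \<open>S\<^sub>n = sinh (h\<omega>\<^sub>n)\<close>. The kernel is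
  \<open>G(h\<beta>) = 1/(2m) \<Sum>n<m. \<omega>\<^sub>n sinh (\<omega>\<^sub>n h \<bar>\<beta>\<bar>)\<close>, and pairing the index \<open>k\<close> with \<open>m - k\<close>, which conjugates
  \<open>C\<^sub>k\<close> and \<open>\<omega>\<^sub>k S\<^sub>k\<close>, shows that the real constants of the theorem only disguise the identities
  \<open>(z\<^sup>2 - 2z cosh h + 1) B(z) = z\<^sup>m q(w)\<close> and \<open>P(z) = z\<^bsup>m-1\<^esup> p(w)\<close>, where \<open>q(w) = \<Prod>n<m. (w - 2C\<^sub>n)\<close>,
  \<open>K p(w) = q(w) \<Sum>n<m. \<omega>\<^sub>n S\<^sub>n / (w - 2C\<^sub>n)\<close> and \<open>K = \<Sum>n<m. \<omega>\<^sub>n S\<^sub>n\<close>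
  (\<open>char_poly_joukowski\<close>, \<open>P_poly_joukowski\<close>, \<open>K_eq_weight_sum\<close>).

  Formally the generating function of \<open>G\<close> is \<open>K p(w) / (m q(w))\<close>, so that of \<open>D\<close> has to be
  \<open>m q(w) / (K p(w))\<close>. The formula for \<open>D\<close> is its partial fraction expansion
  \<open>q(w)/p(w) = w + c + \<Sum>j. r\<^sub>j / (w - w\<^sub>j)\<close> (\<open>partial_fractions\<close>): here \<open>c = M\<^sub>1 - K\<^sub>1/K\<close>, and
  with \<open>w\<^sub>j = \<lambda>\<^sub>j + 1/\<lambda>\<^sub>j\<close> the fraction \<open>1/(w - w\<^sub>j)\<close> generates a multiple of \<open>\<lambda>\<^sub>j\<^bsup>\<bar>\<beta>\<bar>\<^esup>\<close>. As
  \<open>G\<close> grows exponentially, its generating function converges nowhere, and the identity is instead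
  checked on sequences. The convolution of \<open>\<lambda>\<^bsup>\<bar>\<beta>\<bar>\<^esup>\<close> with \<open>u\<^bsup>\<bar>\<beta>\<bar>\<^esup>\<close> is an explicit combination of these
  two sequences (\<open>two_sided_convolution\<close>). Hence \<open>D * G\<close> is a combination of the sequences
  \<open>sinh (\<omega>\<^sub>n h \<bar>\<beta>\<bar>)\<close>, with coefficients proportional to \<open>q(2C\<^sub>n)/p(2C\<^sub>n) = 0\<close>, of the sequences
  \<open>\<lambda>\<^sub>j\<^bsup>\<bar>\<beta>\<bar>\<^esup>\<close>, with coefficients proportional to \<open>p(w\<^sub>j)/q(w\<^sub>j) = 0\<close>, and of the delta sequence, with
  coefficient \<open>(\<Sum>n<m. \<omega>\<^sub>n S\<^sub>n)/K = 1\<close> (\<open>exponential_convolution_inverse\<close>).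

  The smallness of \<open>h\<close> serves to locate the roots of \<open>P\<close>. Averaging an analytic function over the
  \<open>2m\<close>-th roots of unity, with weights \<open>\<omega>\<^sub>n\<close>, leaves only its Taylor coefficients of order
  \<open>2m - 1, 4m - 1, \<dots>\<close>. Therefore, as \<open>h \<rightarrow> 0\<close>, the value \<open>P(x)\<close> at \<open>x < 0\<close> converges to the
  \<open>(2m - 1)\<close>-st derivative of \<open>u \<mapsto> x e\<^sup>u / (1 - x e\<^sup>u)\<close> at \<open>0\<close>, times a factor that does not
  change sign (\<open>P_poly_limit\<close>). For \<open>x = - e\<^sup>t\<close> this derivative is minus the one of the logistic
  function at \<open>t\<close>, and by the theorem of Rolle it alternates in sign at \<open>m\<close> points \<open>t < 0\<close>
  (\<open>logistic_poly_alternates\<close>). So for small \<open>h\<close> the polynomial \<open>P\<close> has \<open>m - 1\<close> roots in \<open>(-1, 0)\<close>,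
  bounded away from \<open>-1\<close> (\<open>P_poly_inner_real_roots\<close>). Since \<open>p\<close> has degree \<open>m - 1\<close>, these are all
  the roots inside the unit disc, and they are simple. They also satisfy
  \<open>\<bar>\<lambda>\<^sub>j\<bar> e\<^sup>h < 1\<close>, which is what makes the convolution converge.
\<close>

section \<open>Convolution of symmetric exponential sequences\<close>

lemma has_sum_geometric:
  fixes z :: complex
  assumes "norm z < 1"
  shows "((\<lambda>k::nat. z ^ k) has_sum (1 / (1 - z))) UNIV"
proof (rule norm_summable_imp_has_sum)
  show "summable (\<lambda>k. norm (z ^ k))"
    using assms by (simp add: norm_power summable_geometric)
  show "(\<lambda>k. z ^ k) sums (1 / (1 - z))"
    using assms by (rule geometric_sums)
qed

text \<open>
  Splitting the range at \<open>0\<close> and at \<open>b\<close> leaves two geometric series of ratio \<open>x u\<close> and one finite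
  geometric sum.
\<close>

lemma two_sided_convolution_nat:
  fixes x u :: complex and b :: nat
  assumes "norm (x * u) < 1" and "x \<noteq> u"
  shows "((\<lambda>\<gamma>::int. x ^ nat \<bar>\<gamma>\<bar> * u ^ nat \<bar>int b - \<gamma>\<bar>) has_sum
      ((x * u / (1 - x * u)) * u ^ b + (u ^ Suc b - x ^ Suc b) / (u - x)
        + (x * u / (1 - x * u)) * x ^ b)) UNIV"
proof -
  let ?f = "\<lambda>\<gamma>::int. x ^ nat \<bar>\<gamma>\<bar> * u ^ nat \<bar>int b - \<gamma>\<bar>"
  note geo = has_sum_geometric[OF assms(1)]
  have neg: "(?f has_sum ((x * u / (1 - x * u)) * u ^ b)) {..<0}"
  proof -
    have "((\<lambda>k::nat. (x * u * u ^ b) * (x * u) ^ k) has_sum (x * u * u ^ b) * (1 / (1 - x * u))) UNIV"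
      by (rule has_sum_cmult_right[OF geo])
    also have "(x * u * u ^ b) * (1 / (1 - x * u)) = (x * u / (1 - x * u)) * u ^ b" by simp
    also have "((\<lambda>k::nat. (x * u * u ^ b) * (x * u) ^ k) has_sum \<dots>) UNIV \<longleftrightarrow> ?thesis"
    proof (rule has_sum_reindex_bij_witness[of _ "\<lambda>\<gamma>. nat (- \<gamma> - 1)" "\<lambda>k. - int k - 1"])
      fix k :: nat
      have 1: "nat \<bar>- int k - 1\<bar> = Suc k" by simp
      have 2: "nat \<bar>int b - (- int k - 1)\<bar> = b + k + 1" by simp
      show "?f (- int k - 1) = x * u * u ^ b * (x * u) ^ k"
        unfolding 1 2 by (simp add: power_add power_mult_distrib)
    qed auto
    finally show ?thesis .
  qed
  have mid: "(?f has_sum ((u ^ Suc b - x ^ Suc b) / (u - x))) {0..int b}"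
  proof (rule has_sum_finiteI)
    have "(\<Sum>\<gamma>\<in>{0..int b}. ?f \<gamma>) = (\<Sum>i<Suc b. x ^ i * u ^ (b - i))"
      by (rule sum.reindex_bij_witness[of _ int nat]) (auto simp: nat_diff_distrib)
    moreover have "u ^ Suc b - x ^ Suc b = (u - x) * (\<Sum>i<Suc b. x ^ i * u ^ (b - i))"
    proof -
      have "x ^ Suc b - u ^ Suc b = (x - u) * (\<Sum>i<Suc b. x ^ i * u ^ (b - i))"
        by (rule diff_power_eq_sum)
      then show ?thesis
        by (metis minus_diff_eq minus_mult_left)
    qed
    ultimately show "(u ^ Suc b - x ^ Suc b) / (u - x) = sum ?f {0..int b}"
      using assms(2) by (simp add: field_simps)
  qed simp
  have pos: "(?f has_sum ((x * u / (1 - x * u)) * x ^ b)) {int b<..}"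
  proof -
    have "((\<lambda>k::nat. (x * u * x ^ b) * (x * u) ^ k) has_sum (x * u * x ^ b) * (1 / (1 - x * u))) UNIV"
      by (rule has_sum_cmult_right[OF geo])
    also have "(x * u * x ^ b) * (1 / (1 - x * u)) = (x * u / (1 - x * u)) * x ^ b" by simp
    also have "((\<lambda>k::nat. (x * u * x ^ b) * (x * u) ^ k) has_sum \<dots>) UNIV \<longleftrightarrow> ?thesis"
    proof (rule has_sum_reindex_bij_witness[of _ "\<lambda>\<gamma>. nat (\<gamma> - int b - 1)" "\<lambda>k. int b + int k + 1"])
      fix k :: nat
      have 1: "nat \<bar>int b + int k + 1\<bar> = b + k + 1" by simp
      have 2: "nat \<bar>int b - (int b + int k + 1)\<bar> = Suc k" by simp
      show "?f (int b + int k + 1) = x * u * x ^ b * (x * u) ^ k"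
        unfolding 1 2 by (simp add: power_add power_mult_distrib)
    qed auto
    finally show ?thesis .
  qed
  have "(?f has_sum ((x * u / (1 - x * u)) * u ^ b + (u ^ Suc b - x ^ Suc b) / (u - x)))
      ({..<0} \<union> {0..int b})"
    by (rule has_sum_Un_disjoint[OF neg mid]) auto
  then have "(?f has_sum ((x * u / (1 - x * u)) * u ^ b + (u ^ Suc b - x ^ Suc b) / (u - x)
        + (x * u / (1 - x * u)) * x ^ b)) ({..<0} \<union> {0..int b} \<union> {int b<..})"
    by (rule has_sum_Un_disjoint[OF _ pos]) auto
  moreover have "{..<0} \<union> {0..int b} \<union> {int b<..} = UNIV" by auto
  ultimately show ?thesis by simp
qed

text \<open>
  The generating function of \<open>a\<^bsup>\<bar>\<beta>\<bar>\<^esup>\<close> is \<open>(1/a - a) / (a + 1/a - (z + 1/z))\<close>. The coefficient of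
  \<open>u\<^bsup>\<bar>\<beta>\<bar>\<^esup>\<close> is its value for \<open>a = x\<close> at \<open>z = u\<close>, that of \<open>x\<^bsup>\<bar>\<beta>\<bar>\<^esup>\<close> its value for \<open>a = u\<close> at
  \<open>z = x\<close>, as a partial fraction expansion of the product of the two generating functions suggests.
  For \<open>\<bar>u\<bar> \<ge> 1\<close> the one of \<open>u\<^bsup>\<bar>\<beta>\<bar>\<^esup>\<close> converges nowhere, but the formula survives because the
  convolution is summable as soon as \<open>\<bar>x u\<bar> < 1\<close>.
\<close>

lemma two_sided_convolution:
  fixes x u :: complex and \<beta> :: int
  assumes "norm (x * u) < 1" and "x \<noteq> u" and "x \<noteq> 0" and "u \<noteq> 0"
  shows "((\<lambda>\<gamma>. x ^ nat \<bar>\<gamma>\<bar> * u ^ nat \<bar>\<beta> - \<gamma>\<bar>) has_sum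
      ((1 / x - x) / (x + 1 / x - (u + 1 / u)) * u ^ nat \<bar>\<beta>\<bar>
       + (u - 1 / u) / (x + 1 / x - (u + 1 / u)) * x ^ nat \<bar>\<beta>\<bar>)) UNIV"
proof -
  define b where "b = nat \<bar>\<beta>\<bar>"
  have xu: "1 - x * u \<noteq> 0" using assms(1) by auto
  have den: "x + 1 / x - (u + 1 / u) = (u - x) * (1 - x * u) / (x * u)"
    using assms(3,4) by (simp add: field_simps)
  have \<kappa>: "(1 / x - x) / (x + 1 / x - (u + 1 / u)) = x * u / (1 - x * u) + u / (u - x)"
    unfolding den using assms xu by (simp add: divide_simps) (simp add: algebra_simps)
  have \<alpha>: "(u - 1 / u) / (x + 1 / x - (u + 1 / u)) = x * u / (1 - x * u) - x / (u - x)"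
    unfolding den using assms xu by (simp add: divide_simps) (simp add: algebra_simps)
  have val: "(x * u / (1 - x * u)) * u ^ b + (u ^ Suc b - x ^ Suc b) / (u - x)
        + (x * u / (1 - x * u)) * x ^ b
      = (1 / x - x) / (x + 1 / x - (u + 1 / u)) * u ^ b
        + (u - 1 / u) / (x + 1 / x - (u + 1 / u)) * x ^ b"
    unfolding \<kappa> \<alpha> by (simp add: distrib_right left_diff_distrib diff_divide_distrib)
  note conv = two_sided_convolution_nat[OF assms(1,2), of b, unfolded val]
  show ?thesis
  proof (cases "\<beta> \<ge> 0")
    case True
    then show ?thesis using conv by (simp add: b_def)
  next
    case False
    have "((\<lambda>\<gamma>::int. x ^ nat \<bar>\<gamma>\<bar> * u ^ nat \<bar>int b - \<gamma>\<bar>) has_sum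
       ((1 / x - x) / (x + 1 / x - (u + 1 / u)) * u ^ b
        + (u - 1 / u) / (x + 1 / x - (u + 1 / u)) * x ^ b)) UNIV \<longleftrightarrow>
      ((\<lambda>\<gamma>. x ^ nat \<bar>\<gamma>\<bar> * u ^ nat \<bar>\<beta> - \<gamma>\<bar>) has_sum
       ((1 / x - x) / (x + 1 / x - (u + 1 / u)) * u ^ b
        + (u - 1 / u) / (x + 1 / x - (u + 1 / u)) * x ^ b)) UNIV"
    proof (rule has_sum_reindex_bij_witness[of _ uminus uminus])
      fix \<gamma> :: int
      have "\<bar>int b - - \<gamma>\<bar> = \<bar>\<beta> - \<gamma>\<bar>" "\<bar>int b - \<gamma>\<bar> = \<bar>\<beta> - - \<gamma>\<bar>"
        using False by (auto simp: b_def)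
      then show "x ^ nat \<bar>- \<gamma>\<bar> * u ^ nat \<bar>\<beta> - - \<gamma>\<bar> = x ^ nat \<bar>\<gamma>\<bar> * u ^ nat \<bar>int b - \<gamma>\<bar>"
        by simp
    qed auto
    then show ?thesis using conv by (simp add: b_def)
  qed
qed

lemma has_sum_sum_finite:
  fixes f :: "'a \<Rightarrow> 'b \<Rightarrow> complex"
  assumes "finite I" and "\<And>i. i \<in> I \<Longrightarrow> ((f i) has_sum (s i)) A"
  shows "((\<lambda>y. \<Sum>i\<in>I. f i y) has_sum (\<Sum>i\<in>I. s i)) A"
  using assms
proof (induction I rule: finite_induct)
  case (insert i I)
  then have "((\<lambda>y. f i y + (\<Sum>i\<in>I. f i y)) has_sum (s i + (\<Sum>i\<in>I. s i))) A"
    by (intro has_sum_add) simp_all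
  with insert show ?case by simp
qed simp

lemma tridiagonal_convolution:
  fixes g :: "int \<Rightarrow> complex"
  shows "((\<lambda>\<gamma>. (if \<gamma> = 0 then c else if \<bar>\<gamma>\<bar> = 1 then 1 else 0) * g (\<beta> - \<gamma>)) has_sum
     (c * g \<beta> + g (\<beta> - 1) + g (\<beta> + 1))) UNIV"
proof (rule has_sum_finite_neutralI[where B = "{-1, 0, 1}"])
  fix \<gamma> :: int
  assume "\<gamma> \<in> UNIV - {-1, 0, 1}"
  then have "\<gamma> \<noteq> 0" "\<bar>\<gamma>\<bar> \<noteq> 1" by auto
  then show "(if \<gamma> = 0 then c else if \<bar>\<gamma>\<bar> = 1 then 1 else 0) * g (\<beta> - \<gamma>) = 0" by simp
qed (simp_all add: add_ac)

text \<open>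
  Off \<open>0\<close> the sequence solves the three-term recurrence with characteristic roots \<open>u\<close> and \<open>1/u\<close>;
  the corner of \<open>\<bar>\<beta>\<bar>\<close> at \<open>0\<close> produces the delta term.
\<close>

lemma shifted_difference_sum:
  fixes u :: complex and \<beta> :: int
  assumes "u \<noteq> 0"
  defines "H \<equiv> \<lambda>\<beta>. u ^ nat \<bar>\<beta>\<bar> - (1 / u) ^ nat \<bar>\<beta>\<bar>"
  shows "H (\<beta> - 1) + H (\<beta> + 1) = (u + 1 / u) * H \<beta> + (if \<beta> = 0 then 2 * (u - 1 / u) else 0)"
proof -
  have H: "H (int k - 1) + H (int k + 1) = (u + 1 / u) * H (int k)" if "k > 0" for k
  proof -
    obtain j where j: "k = Suc j" using \<open>k > 0\<close> gr0_implies_Suc by blast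
    have n: "nat \<bar>int k - 1\<bar> = j" "nat \<bar>int k + 1\<bar> = Suc (Suc j)" "nat \<bar>int k\<bar> = Suc j"
      using j by auto
    have id: "u ^ j - v ^ j + (u ^ Suc (Suc j) - v ^ Suc (Suc j))
        = (u + v) * (u ^ Suc j - v ^ Suc j)" if "u * v = 1" for v
    proof -
      have "(u + v) * (u ^ Suc j - v ^ Suc j)
          = u ^ Suc (Suc j) - v ^ Suc (Suc j) + (u * v) * (u ^ j - v ^ j)"
        by (simp only: power_Suc ring_distribs mult_ac) simp
      then show ?thesis using that by simp
    qed
    have "u * (1 / u) = 1" using assms(1) by simp
    from id[OF this] show ?thesis unfolding H_def n .
  qed
  have even: "H (- \<beta>) = H \<beta>" for \<beta> unfolding H_def by simp
  consider "\<beta> = 0" | "\<beta> > 0" | "\<beta> < 0" by linarith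
  then show ?thesis
  proof cases
    case 1
    then show ?thesis by (simp add: H_def)
  next
    case 2
    then show ?thesis using H[of "nat \<beta>"] by simp
  next
    case 3
    then have "H (- (\<beta> + 1)) + H (- (\<beta> - 1)) = (u + 1 / u) * H (- \<beta>)"
      using H[of "nat (- \<beta>)"] by simp
    then show ?thesis
      unfolding even using 3 by (simp add: add.commute)
  qed
qed

text \<open>
  The three hypotheses \<open>symbol\<close>, \<open>kernel\<close> and \<open>norming\<close> say that the coefficients of the differences
  \<open>u\<^bsup>\<bar>\<beta>\<bar>\<^esup> - u\<^bsup>-\<bar>\<beta>\<bar>\<^esup>\<close>, of the sequences \<open>x\<^bsup>\<bar>\<beta>\<bar>\<^esup>\<close> and of the delta sequence in the convolution are \<open>0\<close>,
  \<open>0\<close> and \<open>1\<close>. The first coefficient depends on \<open>u\<close> through \<open>u + 1/u\<close> only, so that a single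
  condition takes care of \<open>u\<close> and \<open>1/u\<close>.
\<close>

lemma exponential_convolution_inverse:
  fixes u w :: "'j \<Rightarrow> complex" and X :: "complex set" and B :: "complex \<Rightarrow> complex"
  assumes "finite X" and "finite J"
    and X: "\<And>x j. x \<in> X \<Longrightarrow> j \<in> J \<Longrightarrow> norm (x * u j) < 1 \<and> norm (x / u j) < 1"
    and nz: "0 \<notin> X" "\<And>j. j \<in> J \<Longrightarrow> u j \<noteq> 0"
    and symbol: "\<And>j. j \<in> J \<Longrightarrow>
       u j + 1 / u j + c + (\<Sum>x\<in>X. B x * ((1 / x - x) / (x + 1 / x - (u j + 1 / u j)))) = 0"
    and kernel: "\<And>x. x \<in> X \<Longrightarrow> (\<Sum>j\<in>J. w j * ((u j - 1 / u j) / (x + 1 / x - (u j + 1 / u j)))) = 0"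
    and norming: "2 * (\<Sum>j\<in>J. w j * (u j - 1 / u j)) = 1"
  defines "d \<equiv> \<lambda>\<gamma>::int. (if \<gamma> = 0 then c else if \<bar>\<gamma>\<bar> = 1 then 1 else 0) + (\<Sum>x\<in>X. B x * x ^ nat \<bar>\<gamma>\<bar>)"
    and "g \<equiv> \<lambda>\<gamma>::int. \<Sum>j\<in>J. w j * (u j ^ nat \<bar>\<gamma>\<bar> - (1 / u j) ^ nat \<bar>\<gamma>\<bar>)"
  shows "((\<lambda>\<gamma>. d \<gamma> * g (\<beta> - \<gamma>)) has_sum (if \<beta> = 0 then 1 else 0)) UNIV"
proof -
  define H where "H = (\<lambda>j (\<gamma>::int). u j ^ nat \<bar>\<gamma>\<bar> - (1 / u j) ^ nat \<bar>\<gamma>\<bar>)"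
  define \<kappa> where "\<kappa> = (\<lambda>x j. (1 / x - x) / (x + 1 / x - (u j + 1 / u j)))"
  define \<alpha> where "\<alpha> = (\<lambda>x j. (u j - 1 / u j) / (x + 1 / x - (u j + 1 / u j)))"
  have conv: "((\<lambda>\<gamma>. x ^ nat \<bar>\<gamma>\<bar> * H j (\<beta> - \<gamma>)) has_sum
      (\<kappa> x j * H j \<beta> + 2 * \<alpha> x j * x ^ nat \<bar>\<beta>\<bar>)) UNIV"
    if x: "x \<in> X" and j: "j \<in> J" for x j
  proof -
    have 0: "x \<noteq> 0" "u j \<noteq> 0" using x j nz by auto
    have ne: "x \<noteq> u j" "x \<noteq> 1 / u j" using X[OF x j] 0 by auto
      have pos: "((\<lambda>\<gamma>. x ^ nat \<bar>\<gamma>\<bar> * u j ^ nat \<bar>\<beta> - \<gamma>\<bar>) has_sum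
          (\<kappa> x j * u j ^ nat \<bar>\<beta>\<bar> + \<alpha> x j * x ^ nat \<bar>\<beta>\<bar>)) UNIV"
        unfolding \<kappa>_def \<alpha>_def by (rule two_sided_convolution) (use X[OF x j] 0 ne in auto)
      have e: "\<kappa> x j * (1 / u j) ^ nat \<bar>\<beta>\<bar> - \<alpha> x j * x ^ nat \<bar>\<beta>\<bar> =
        (1 / x - x) / (x + 1 / x - (1 / u j + 1 / (1 / u j))) * (1 / u j) ^ nat \<bar>\<beta>\<bar>
         + (1 / u j - 1 / (1 / u j)) / (x + 1 / x - (1 / u j + 1 / (1 / u j))) * x ^ nat \<bar>\<beta>\<bar>"
      proof -
        have e1: "1 / u j + 1 / (1 / u j) = u j + 1 / u j" by simp
        have e2: "1 / u j - 1 / (1 / u j) = - (u j - 1 / u j)" by simp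
        show ?thesis
          unfolding \<kappa>_def \<alpha>_def e1 e2 minus_divide_left [symmetric] by (simp only: mult_minus_left diff_conv_add_uminus)
      qed
      have neg: "((\<lambda>\<gamma>. x ^ nat \<bar>\<gamma>\<bar> * (1 / u j) ^ nat \<bar>\<beta> - \<gamma>\<bar>) has_sum
          (\<kappa> x j * (1 / u j) ^ nat \<bar>\<beta>\<bar> - \<alpha> x j * x ^ nat \<bar>\<beta>\<bar>)) UNIV"
        unfolding e by (rule two_sided_convolution) (use X[OF x j] 0 ne in auto)
    show ?thesis
      using has_sum_add[OF pos has_sum_uminusI[OF neg]] by (simp add: H_def algebra_simps)
  qed
  have "((\<lambda>\<gamma>. (if \<gamma> = 0 then c else if \<bar>\<gamma>\<bar> = 1 then 1 else 0) * g (\<beta> - \<gamma>)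
          + (\<Sum>x\<in>X. \<Sum>j\<in>J. (B x * w j) * (x ^ nat \<bar>\<gamma>\<bar> * H j (\<beta> - \<gamma>)))) has_sum
        ((c * g \<beta> + g (\<beta> - 1) + g (\<beta> + 1))
          + (\<Sum>x\<in>X. \<Sum>j\<in>J. (B x * w j) * (\<kappa> x j * H j \<beta> + 2 * \<alpha> x j * x ^ nat \<bar>\<beta>\<bar>)))) UNIV"
    by (intro has_sum_add tridiagonal_convolution has_sum_sum_finite has_sum_cmult_right conv assms(1,2))
  moreover have "(if \<gamma> = 0 then c else if \<bar>\<gamma>\<bar> = 1 then 1 else 0) * g (\<beta> - \<gamma>)
          + (\<Sum>x\<in>X. \<Sum>j\<in>J. (B x * w j) * (x ^ nat \<bar>\<gamma>\<bar> * H j (\<beta> - \<gamma>))) = d \<gamma> * g (\<beta> - \<gamma>)" for \<gamma>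
    unfolding d_def g_def H_def distrib_right
    by (simp add: sum_product mult_ac)
  moreover have "(c * g \<beta> + g (\<beta> - 1) + g (\<beta> + 1))
          + (\<Sum>x\<in>X. \<Sum>j\<in>J. (B x * w j) * (\<kappa> x j * H j \<beta> + 2 * \<alpha> x j * x ^ nat \<bar>\<beta>\<bar>))
        = (if \<beta> = 0 then 1 else 0)"
  proof -
    have 1: "c * g \<beta> + g (\<beta> - 1) + g (\<beta> + 1)
       = (\<Sum>j\<in>J. w j * ((u j + 1 / u j + c) * H j \<beta>)) + (if \<beta> = 0 then 1 else 0)"
    proof -
      have "c * g \<beta> + g (\<beta> - 1) + g (\<beta> + 1)
          = (\<Sum>j\<in>J. w j * (c * H j \<beta> + (H j (\<beta> - 1) + H j (\<beta> + 1))))"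
        unfolding g_def H_def by (simp add: sum_distrib_left sum.distrib[symmetric] algebra_simps)
      also have "\<dots> = (\<Sum>j\<in>J. w j * ((u j + 1 / u j + c) * H j \<beta>)
                              + (if \<beta> = 0 then 2 * (w j * (u j - 1 / u j)) else 0))"
      proof (rule sum.cong[OF refl])
        fix j assume "j \<in> J"
        then have "H j (\<beta> - 1) + H j (\<beta> + 1)
            = (u j + 1 / u j) * H j \<beta> + (if \<beta> = 0 then 2 * (u j - 1 / u j) else 0)"
          unfolding H_def by (intro shifted_difference_sum nz)
        then show "w j * (c * H j \<beta> + (H j (\<beta> - 1) + H j (\<beta> + 1))) =
          w j * ((u j + 1 / u j + c) * H j \<beta>) + (if \<beta> = 0 then 2 * (w j * (u j - 1 / u j)) else 0)"
          by (simp add: algebra_simps)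
      qed
      also have "\<dots> = (\<Sum>j\<in>J. w j * ((u j + 1 / u j + c) * H j \<beta>)) + (if \<beta> = 0 then 1 else 0)"
        using norming by (simp add: sum.distrib sum_distrib_left)
      finally show ?thesis .
    qed
    have 2: "(\<Sum>x\<in>X. \<Sum>j\<in>J. (B x * w j) * (\<kappa> x j * H j \<beta> + 2 * \<alpha> x j * x ^ nat \<bar>\<beta>\<bar>))
       = (\<Sum>j\<in>J. w j * ((\<Sum>x\<in>X. B x * \<kappa> x j) * H j \<beta>))
         + (\<Sum>x\<in>X. 2 * B x * x ^ nat \<bar>\<beta>\<bar> * (\<Sum>j\<in>J. w j * \<alpha> x j))"
    proof -
      have "(\<Sum>x\<in>X. \<Sum>j\<in>J. (B x * w j) * (\<kappa> x j * H j \<beta> + 2 * \<alpha> x j * x ^ nat \<bar>\<beta>\<bar>))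
         = (\<Sum>x\<in>X. \<Sum>j\<in>J. w j * (B x * \<kappa> x j * H j \<beta>))
           + (\<Sum>x\<in>X. \<Sum>j\<in>J. 2 * B x * x ^ nat \<bar>\<beta>\<bar> * (w j * \<alpha> x j))"
        by (simp add: sum.distrib[symmetric] algebra_simps)
      also have "(\<Sum>x\<in>X. \<Sum>j\<in>J. w j * (B x * \<kappa> x j * H j \<beta>))
         = (\<Sum>j\<in>J. \<Sum>x\<in>X. w j * (B x * \<kappa> x j * H j \<beta>))" by (rule sum.swap)
      finally show ?thesis by (simp add: sum_distrib_left sum_distrib_right mult_ac)
    qed
    have 3: "(\<Sum>j\<in>J. w j * \<alpha> x j) = 0" if "x \<in> X" for x
      using kernel[OF that] by (simp add: \<alpha>_def)
    have 4: "(\<Sum>j\<in>J. w j * ((u j + 1 / u j + c) * H j \<beta>))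
         + (\<Sum>j\<in>J. w j * ((\<Sum>x\<in>X. B x * \<kappa> x j) * H j \<beta>)) = 0"
    proof -
      have "w j * ((u j + 1 / u j + c) * H j \<beta>) + w j * ((\<Sum>x\<in>X. B x * \<kappa> x j) * H j \<beta>) = 0"
        if "j \<in> J" for j
      proof -
        have "w j * ((u j + 1 / u j + c) * H j \<beta>) + w j * ((\<Sum>x\<in>X. B x * \<kappa> x j) * H j \<beta>)
           = w j * H j \<beta> * (u j + 1 / u j + c + (\<Sum>x\<in>X. B x * \<kappa> x j))"
          by (simp add: algebra_simps)
        then show ?thesis using symbol[OF that] by (simp add: \<kappa>_def)
      qed
      then show ?thesis by (simp add: sum.distrib[symmetric])
    qed
    show ?thesis unfolding 1 2 using 3 4 by (simp add: algebra_simps)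
  qed
  ultimately show ?thesis by simp
qed

section \<open>The variable \<open>z + 1/z\<close>\<close>

context comm_monoid_set
begin

text \<open>
  Stated in the locale of commutative monoids because sums and products over the indices \<open>n < m\<close>
  are both grouped into the pairs \<open>{k, m - k}\<close>.
\<close>

lemma reflect_pairs:
  assumes "odd (m::nat)"
  shows "F g {..<m} = g 0 \<^bold>* F (\<lambda>k. g k \<^bold>* g (m - k)) {1..(m - 1) div 2}"
proof -
  obtain M where m: "m = 2 * M + 1" using assms by (elim oddE)
  have split: "{..<m} = insert 0 ({1..M} \<union> (\<lambda>k. m - k) ` {1..M})"
  proof (intro equalityI subsetI)
    fix i assume i: "i \<in> {..<m}"
    consider "i = 0" | "1 \<le> i \<and> i \<le> M" | "M < i" by linarith
    then show "i \<in> insert 0 ({1..M} \<union> (\<lambda>k. m - k) ` {1..M})"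
    proof cases
      case 3
      then have "i = m - (m - i)" "m - i \<in> {1..M}" using i m by auto
      then show ?thesis by blast
    qed auto
  qed (use m in auto)
  have inj: "inj_on (\<lambda>k. m - k) {1..M}" by (rule inj_onI) (use m in auto)
  have "F g {..<m} = g 0 \<^bold>* F g ({1..M} \<union> (\<lambda>k. m - k) ` {1..M})"
    unfolding split by (rule insert) (use m in auto)
  also have "F g ({1..M} \<union> (\<lambda>k. m - k) ` {1..M}) = F g {1..M} \<^bold>* F g ((\<lambda>k. m - k) ` {1..M})"
    by (rule union_disjoint) (use m in auto)
  also have "F g ((\<lambda>k. m - k) ` {1..M}) = F (\<lambda>k. g (m - k)) {1..M}"
    by (subst reindex[OF inj]) (simp add: o_def)
  finally show ?thesis using m by (simp add: distrib)
qed

lemma reflect_pairs_remove: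
  assumes "odd (m::nat)" and j: "j \<in> {1..(m - 1) div 2}" and i: "i = j \<and> i' = m - j \<or> i = m - j \<and> i' = j"
  shows "F g ({..<m} - {i})
    = g 0 \<^bold>* (g i' \<^bold>* F (\<lambda>k. g k \<^bold>* g (m - k)) ({1..(m - 1) div 2} - {j}))"
proof -
  obtain M where m: "m = 2 * M + 1" using assms by (elim oddE)
  define g' where "g' = g(i := \<^bold>1)"
  have im: "i < m" "i \<noteq> i'" "i \<noteq> 0" using i j m by auto
  have "F g' {..<m} = g' i \<^bold>* F g' ({..<m} - {i})"
    using im by (intro remove) auto
  also have "\<dots> = F g ({..<m} - {i})"
    by (auto simp: g'_def intro!: cong)
  finally have "F g ({..<m} - {i}) = F g' {..<m}" ..
  also have "\<dots> = g' 0 \<^bold>* F (\<lambda>k. g' k \<^bold>* g' (m - k)) {1..(m - 1) div 2}"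
    by (rule reflect_pairs[OF assms(1)])
  also have "F (\<lambda>k. g' k \<^bold>* g' (m - k)) {1..(m - 1) div 2}
      = (g' j \<^bold>* g' (m - j)) \<^bold>* F (\<lambda>k. g' k \<^bold>* g' (m - k)) ({1..(m - 1) div 2} - {j})"
    using j by (intro remove) auto
  also have "g' j \<^bold>* g' (m - j) = g i'" using i im by (auto simp: g'_def)
  also have "F (\<lambda>k. g' k \<^bold>* g' (m - k)) ({1..(m - 1) div 2} - {j})
      = F (\<lambda>k. g k \<^bold>* g (m - k)) ({1..(m - 1) div 2} - {j})"
  proof (rule cong[OF refl])
    fix k assume "k \<in> {1..(m - 1) div 2} - {j}"
    then have "k \<noteq> i" "m - k \<noteq> i" using i j m by auto
    then show "g' k \<^bold>* g' (m - k) = g k \<^bold>* g (m - k)" by (simp add: g'_def)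
  qed
  also have "g' 0 = g 0" using im by (simp add: g'_def)
  finally show ?thesis .
qed

end

definition unity_root :: "nat \<Rightarrow> nat \<Rightarrow> complex" where
  "unity_root m n = cis (pi * real n / real m)"

text \<open>
  Twice the hyperbolic cosine is \<open>u + 1/u\<close> for \<open>u = exp (h \<omega>\<^sub>n)\<close>: the nodes are the images of the
  characteristic roots \<open>u\<close> under \<open>z \<mapsto> z + 1/z\<close>.
\<close>

definition node :: "nat \<Rightarrow> real \<Rightarrow> nat \<Rightarrow> complex" where
  "node m h n = 2 * cosh (of_real h * unity_root m n)"

definition weight :: "nat \<Rightarrow> real \<Rightarrow> nat \<Rightarrow> complex" where
  "weight m h n = unity_root m n * sinh (of_real h * unity_root m n)"

definition char_poly :: "nat \<Rightarrow> real \<Rightarrow> complex poly" where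
  "char_poly m h = (\<Prod>n<m. [:- node m h n, 1:])"

text \<open>
  The polynomial \<open>p\<close> with \<open>P(z) = z\<^bsup>m-1\<^esup> p(z + 1/z)\<close>; the products over \<open>i \<noteq> n\<close> are \<open>char_poly\<close>
  with the factor of index \<open>n\<close> cancelled.
\<close>

definition reduced_P :: "nat \<Rightarrow> real \<Rightarrow> complex poly" where
  "reduced_P m h = smult (1 / of_real (K m h))
     (\<Sum>n<m. smult (weight m h n) (\<Prod>i\<in>{..<m} - {n}. [:- node m h i, 1:]))"

lemma unity_root_0 [simp]: "unity_root m 0 = 1"
  by (simp add: unity_root_def)

lemma norm_unity_root [simp]: "norm (unity_root m n) = 1"
  by (simp add: unity_root_def)

text \<open>
  This reflection is what makes a pair of indices \<open>k\<close>, \<open>m - k\<close> contribute real quantities: the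
  functions \<open>\<omega> \<mapsto> cosh (h \<omega>)\<close> and \<open>\<omega> \<mapsto> \<omega> sinh (h \<omega>)\<close> are even, so their values at the two indices
  are complex conjugates.
\<close>

lemma unity_root_reflect:
  assumes "0 < k" and "k < m"
  shows "unity_root m (m - k) = - cnj (unity_root m k)"
proof -
  have "pi * real (m - k) / real m = pi - pi * real k / real m"
    using assms by (simp add: of_nat_diff field_simps)
  then show ?thesis by (simp add: unity_root_def complex_eq_iff)
qed

lemma cosh_Complex: "cosh (Complex a b) = Complex (cosh a * cos b) (sinh a * sin b)"
  by (simp add: complex_eq_iff cosh_field_def sinh_field_def Re_exp Im_exp field_simps)

lemma sinh_Complex: "sinh (Complex a b) = Complex (sinh a * cos b) (cosh a * sin b)"
  by (simp add: complex_eq_iff cosh_field_def sinh_field_def Re_exp Im_exp field_simps)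

lemma cosh_cnj: "cosh (cnj z) = cnj (cosh z)"
  by (simp add: cosh_field_def exp_cnj)

lemma sinh_cnj: "sinh (cnj z) = cnj (sinh z)"
  by (simp add: sinh_field_def exp_cnj)

lemma scaled_unity_root:
  "of_real h * unity_root m n = Complex (h * cos (pi * real n / real m)) (h * sin (pi * real n / real m))"
  by (simp add: unity_root_def complex_eq_iff)

lemma node_0 [simp]: "node m h 0 = of_real (2 * cosh h)"
  by (simp add: node_def cosh_Complex complex_eq_iff scaled_unity_root[of h m 0, simplified])

lemma weight_0 [simp]: "weight m h 0 = of_real (sinh h)"
  by (simp add: weight_def sinh_Complex complex_eq_iff scaled_unity_root[of h m 0, simplified])

lemma node_reflect:
  assumes "0 < k" and "k < m"
  shows "node m h (m - k) = cnj (node m h k)"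
  using cosh_cnj[of "of_real h * unity_root m k"] by (simp add: node_def unity_root_reflect[OF assms])

lemma weight_reflect:
  assumes "0 < k" and "k < m"
  shows "weight m h (m - k) = cnj (weight m h k)"
  using sinh_cnj[of "of_real h * unity_root m k"] by (simp add: weight_def unity_root_reflect[OF assms])

lemma node_pair_sum:
  assumes "0 < k" and "k < m"
  shows "node m h k + node m h (m - k) = - of_real (b1 m h k)"
  unfolding node_reflect[OF assms]
  by (simp add: node_def b1_def scaled_unity_root cosh_Complex complex_eq_iff)

lemma node_pair_prod:
  assumes "0 < k" and "k < m"
  shows "node m h k * node m h (m - k) = of_real (b2 m h k) - 2"
proof -
  define a b where "a = h * cos (pi * real k / real m)" and "b = h * sin (pi * real k / real m)"
  have "node m h k = Complex (2 * (cosh a * cos b)) (2 * (sinh a * sin b))"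
    by (simp add: node_def scaled_unity_root cosh_Complex complex_eq_iff a_def b_def)
  then have "node m h k * node m h (m - k) = of_real (4 * ((cosh a * cos b)\<^sup>2 + (sinh a * sin b)\<^sup>2))"
    unfolding node_reflect[OF assms] by (simp add: complex_eq_iff power2_eq_square)
  also have "4 * ((cosh a * cos b)\<^sup>2 + (sinh a * sin b)\<^sup>2) = 2 * (cosh (2 * a) + cos (2 * b))"
  proof -
    have "(cosh a)\<^sup>2 = 1 + (sinh a)\<^sup>2" "(sin b)\<^sup>2 = 1 - (cos b)\<^sup>2"
      by (simp_all add: cosh_square_eq sin_squared_eq)
    moreover have "4 * (C * c + S * s) = 2 * ((C + S) + (c - s))"
      if "C = 1 + S" "s = 1 - c" for C S c s :: real
      unfolding that by (simp add: algebra_simps)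
    ultimately show ?thesis
      unfolding cosh_double cos_double power_mult_distrib by metis
  qed
  also have "\<dots> = b2 m h k - 2" by (simp add: b2_def a_def b_def mult.assoc)
  finally show ?thesis by simp
qed

lemma weight_pair_sum:
  assumes "0 < k" and "k < m"
  shows "weight m h k + weight m h (m - k) = of_real (a1 m h k)"
  unfolding weight_reflect[OF assms]
  by (simp add: weight_def a1_def scaled_unity_root sinh_Complex complex_eq_iff)
    (simp add: unity_root_def algebra_simps)

lemma weight_node_pair_sum:
  assumes "0 < k" and "k < m"
  shows "weight m h k * node m h (m - k) + weight m h (m - k) * node m h k = - of_real (a2 m h k)"
proof -
  define a b t where "a = h * cos (pi * real k / real m)" and "b = h * sin (pi * real k / real m)"
    and "t = pi * real k / real m"
  define S C where "S = sinh (Complex a b)" and "C = cosh (Complex a b)"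
  have u: "unity_root m k = Complex (cos t) (sin t)"
    by (simp add: unity_root_def t_def complex_eq_iff)
  have SC: "S * cnj C = Complex (sinh a * cosh a) (sin b * cos b)"
  proof -
    have "sinh a * cos b * (cosh a * cos b) + cosh a * sin b * (sinh a * sin b)
        = sinh a * cosh a * ((sin b)\<^sup>2 + (cos b)\<^sup>2)"
      by (simp add: power2_eq_square algebra_simps del: sin_cos_squared_add sin_cos_squared_add2 sin_cos_squared_add3)
    moreover have "cosh a * sin b * (cosh a * cos b) - sinh a * cos b * (sinh a * sin b)
        = sin b * cos b * ((cosh a)\<^sup>2 - (sinh a)\<^sup>2)"
      by (simp add: power2_eq_square algebra_simps)
    ultimately show ?thesis
      by (simp add: S_def C_def sinh_Complex cosh_Complex complex_eq_iff cosh_square_eq)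
  qed
  have "weight m h k * node m h (m - k) = 2 * (unity_root m k * (S * cnj C))"
    unfolding node_reflect[OF assms]
    by (simp add: weight_def node_def scaled_unity_root S_def C_def a_def b_def)
  moreover have "weight m h (m - k) * node m h k = cnj (weight m h k * node m h (m - k))"
    unfolding node_reflect[OF assms] weight_reflect[OF assms] by simp
  ultimately have "weight m h k * node m h (m - k) + weight m h (m - k) * node m h k
      = of_real (4 * (cos t * (sinh a * cosh a) - sin t * (sin b * cos b)))"
    unfolding u SC by (simp add: complex_eq_iff)
  also have "4 * (cos t * (sinh a * cosh a) - sin t * (sin b * cos b))
      = 2 * (cos t * sinh (2 * a) - sin t * sin (2 * b))"
    by (simp add: sinh_double sin_double)
  also have "\<dots> = - a2 m h k" by (simp add: a2_def a_def b_def t_def mult.assoc)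
  finally show ?thesis by simp
qed

lemma pair_range:
  fixes k m :: nat
  assumes "k \<in> {1..(m - 1) div 2}"
  shows "0 < k \<and> k < m"
  using assms by auto

lemma K_eq_weight_sum:
  assumes "odd m"
  shows "of_real (K m h) = (\<Sum>n<m. weight m h n)"
proof -
  have "(\<Sum>k\<in>{1..(m - 1) div 2}. weight m h k + weight m h (m - k))
      = (\<Sum>k\<in>{1..(m - 1) div 2}. of_real (a1 m h k))"
    by (rule sum.cong[OF refl]) (use pair_range weight_pair_sum in blast)
  then show ?thesis
    unfolding sum.reflect_pairs[OF assms, of "weight m h"] by (simp add: K_def)
qed

lemma M1_eq_node_sum:
  assumes "odd m"
  shows "of_real (M1 m h) = - (\<Sum>n<m. node m h n)"
proof -
  have "(\<Sum>k\<in>{1..(m - 1) div 2}. node m h k + node m h (m - k))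
      = (\<Sum>k\<in>{1..(m - 1) div 2}. - of_real (b1 m h k))"
    by (rule sum.cong[OF refl]) (use pair_range node_pair_sum in blast)
  then show ?thesis
    unfolding sum.reflect_pairs[OF assms, of "node m h"] by (simp add: M1_def sum_negf)
qed

text \<open>
  The right-hand side is \<open>K\<close> times the second highest coefficient of \<open>reduced_P\<close>, computed summand
  by summand.
\<close>

lemma K1_eq_weight_node_sum:
  assumes "odd m"
  shows "of_real (K1 m h) = - (\<Sum>n<m. weight m h n * (\<Sum>i\<in>{..<m} - {n}. node m h i))"
proof -
  define J where "J = {1..(m - 1) div 2}"
  define T where "T = (\<lambda>n. weight m h n * (\<Sum>i\<in>{..<m} - {n}. node m h i))"
  have pair: "node m h k + node m h (m - k) = - of_real (b1 m h k)" if "k \<in> J" for k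
    using pair_range[of k m] that node_pair_sum unfolding J_def by blast
  have S0: "(\<Sum>i\<in>{..<m} - {0}. node m h i) = - of_real (\<Sum>k\<in>J. b1 m h k)"
  proof -
    have "(\<Sum>i<m. node m h i) = node m h 0 + (\<Sum>i\<in>{..<m} - {0}. node m h i)"
      using assms by (intro sum.remove) (auto simp: odd_pos)
    then show ?thesis
      unfolding sum.reflect_pairs[OF assms, of "node m h"] using pair by (simp add: J_def sum_negf)
  qed
  have T0: "T 0 = - of_real (\<Sum>k\<in>J. b1 m h k * sinh h)"
    unfolding T_def S0 by (simp add: sum_distrib_left mult.commute)
  have Tk: "T k + T (m - k) = - of_real (a2 m h k
       + a1 m h k * ((\<Sum>j\<in>J - {k}. b1 m h j) - 2 * cosh h))" if k: "k \<in> J" for k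
  proof -
    have km: "0 < k" "k < m" using k pair_range unfolding J_def by auto
    have rest: "(\<Sum>j\<in>J - {k}. node m h j + node m h (m - j)) = - of_real (\<Sum>j\<in>J - {k}. b1 m h j)"
      using pair by (simp add: sum_negf)
    have Sk: "(\<Sum>i\<in>{..<m} - {k}. node m h i)
        = node m h 0 + (node m h (m - k) + (\<Sum>j\<in>J - {k}. node m h j + node m h (m - j)))"
      using k unfolding J_def by (intro sum.reflect_pairs_remove assms) auto
    have Smk: "(\<Sum>i\<in>{..<m} - {m - k}. node m h i)
        = node m h 0 + (node m h k + (\<Sum>j\<in>J - {k}. node m h j + node m h (m - j)))"
      using k unfolding J_def by (intro sum.reflect_pairs_remove assms) auto
    have "T k + T (m - k)
      = (weight m h k + weight m h (m - k)) * of_real (2 * cosh h - (\<Sum>j\<in>J - {k}. b1 m h j))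
        + (weight m h k * node m h (m - k) + weight m h (m - k) * node m h k)"
      unfolding T_def Sk Smk rest by (simp add: algebra_simps)
    then show ?thesis
      unfolding weight_pair_sum[OF km] weight_node_pair_sum[OF km] by (simp add: algebra_simps)
  qed
  have "(\<Sum>n<m. T n) = T 0 + (\<Sum>k\<in>J. T k + T (m - k))"
    unfolding J_def by (rule sum.reflect_pairs[OF assms])
  also have "\<dots> = - of_real (K1 m h)"
  proof -
    have "(\<Sum>k\<in>J. T k + T (m - k)) = - of_real (\<Sum>k\<in>J. a2 m h k
       + a1 m h k * ((\<Sum>j\<in>J - {k}. b1 m h j) - 2 * cosh h))"
      unfolding of_real_sum sum_negf[symmetric] using Tk by (rule sum.cong[OF refl])
    moreover have "K1 m h = (\<Sum>k\<in>J. b1 m h k * sinh h) + (\<Sum>k\<in>J. a2 m h k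
       + a1 m h k * ((\<Sum>j\<in>J - {k}. b1 m h j) - 2 * cosh h))"
      unfolding K1_def J_def by (simp only: sum.distrib add.assoc)
    ultimately show ?thesis unfolding T0 by simp
  qed
  finally show ?thesis unfolding T_def by simp
qed

lemma poly_quartic_joukowski:
  assumes "z \<noteq> 0" and "0 < k" and "k < m"
  defines "w \<equiv> z + 1 / z"
  shows "poly (quartic m h k) z = z\<^sup>2 * ((w - node m h k) * (w - node m h (m - k)))"
proof -
  have "(w - node m h k) * (w - node m h (m - k))
      = w\<^sup>2 - (node m h k + node m h (m - k)) * w + node m h k * node m h (m - k)"
    by (simp add: algebra_simps power2_eq_square)
  also have "\<dots> = w\<^sup>2 + of_real (b1 m h k) * w + of_real (b2 m h k) - 2"
    unfolding node_pair_sum[OF assms(2,3)] node_pair_prod[OF assms(2,3)] by simp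
  finally have e: "(w - node m h k) * (w - node m h (m - k))
      = w\<^sup>2 + of_real (b1 m h k) * w + of_real (b2 m h k) - 2" .
  have zw: "z * w = z\<^sup>2 + 1" using assms(1) by (simp add: w_def field_simps power2_eq_square)
  have "z\<^sup>2 * (w\<^sup>2 + of_real (b1 m h k) * w + of_real (b2 m h k) - 2)
      = (z * w)\<^sup>2 + of_real (b1 m h k) * z * (z * w) + of_real (b2 m h k) * z\<^sup>2 - 2 * z\<^sup>2"
    by (simp add: algebra_simps power2_eq_square)
  also have "\<dots> = poly (quartic m h k) z"
    unfolding zw quartic_def by (simp add: algebra_simps power2_eq_square)
  finally show ?thesis unfolding e by simp
qed

lemma central_quadratic_joukowski:
  assumes "z \<noteq> 0"
  shows "z\<^sup>2 - 2 * z * of_real (cosh h) + 1 = z * (z + 1 / z - node m h 0)"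
  using assms by (simp add: field_simps power2_eq_square)

lemma char_poly_joukowski:
  assumes "odd m" and "z \<noteq> 0"
  shows "(z\<^sup>2 - 2 * z * of_real (cosh h) + 1) * poly (B_poly m h) z
      = z ^ m * poly (char_poly m h) (z + 1 / z)"
proof -
  define f where "f = (\<lambda>n. z + 1 / z - node m h n)"
  have m: "z ^ m = z * (\<Prod>k\<in>{1..(m - 1) div 2}. z\<^sup>2)"
  proof -
    have "m = Suc (2 * ((m - 1) div 2))" using assms(1) by (auto elim!: oddE)
    then have "z ^ m = z ^ Suc (2 * ((m - 1) div 2))" by (rule arg_cong)
    then show ?thesis by (simp add: power_mult)
  qed
  have "poly (B_poly m h) z = (\<Prod>k\<in>{1..(m - 1) div 2}. z\<^sup>2 * (f k * f (m - k)))"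
    unfolding B_poly_def poly_prod f_def
    using poly_quartic_joukowski[OF assms(2)] pair_range by (intro prod.cong) blast+
  moreover have "poly (char_poly m h) (z + 1 / z)
     = f 0 * (\<Prod>k\<in>{1..(m - 1) div 2}. f k * f (m - k))"
    unfolding char_poly_def poly_prod
    using prod.reflect_pairs[OF assms(1), of f] by (simp add: f_def)
  ultimately show ?thesis
    unfolding central_quadratic_joukowski[OF assms(2), of h m] m
    by (simp add: f_def prod.distrib mult_ac)
qed

text \<open>
  The summands \<open>j\<close> and \<open>m - j\<close> of \<open>reduced_P\<close> combine to the \<open>j\<close>-th summand of \<open>P_poly\<close>; a factor
  \<open>z\<close> for the numerator, another one for the node of index \<open>0\<close> and \<open>z\<^sup>2\<close> for every remaining pair of
  nodes clear the powers of \<open>1/z\<close> and use up \<open>z\<^bsup>m-1\<^esup>\<close>.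
\<close>

lemma P_poly_joukowski:
  assumes "odd m" and "z \<noteq> 0"
  shows "poly (P_poly m h) z = z ^ (m - 1) * poly (reduced_P m h) (z + 1 / z)"
proof -
  define J where "J = {1..(m - 1) div 2}"
  define f where "f = (\<lambda>n. z + 1 / z - node m h n)"
  define R where "R = (\<lambda>n. weight m h n * (\<Prod>i\<in>{..<m} - {n}. f i))"
  have zm: "z ^ (m - 1) = (\<Prod>k\<in>J. z\<^sup>2)"
  proof -
    have "m - 1 = 2 * ((m - 1) div 2)" using assms(1) by (auto elim!: oddE)
    then have "z ^ (m - 1) = z ^ (2 * ((m - 1) div 2))" by (rule arg_cong)
    then show ?thesis by (simp add: power_mult J_def)
  qed
  have quart: "poly (quartic m h k) z = z\<^sup>2 * (f k * f (m - k))" if "k \<in> J" for k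
    using pair_range[of k m] that poly_quartic_joukowski[OF assms(2)] unfolding J_def f_def by blast
  have B: "poly (B_poly m h) z = z ^ (m - 1) * (\<Prod>k\<in>J. f k * f (m - k))"
    unfolding B_poly_def poly_prod zm J_def[symmetric] using quart by (simp add: prod.distrib)
  have R0: "z ^ (m - 1) * R 0 = of_real (sinh h) * poly (B_poly m h) z"
  proof -
    have "(\<Prod>i\<in>{..<m} - {0}. f i) = (\<Prod>k\<in>J. f k * f (m - k))"
    proof -
      define g where "g = f(0 := 1)"
      have "(\<Prod>i<m. g i) = g 0 * (\<Prod>i\<in>{..<m} - {0}. g i)"
        using assms(1) by (intro prod.remove) (auto simp: odd_pos)
      also have "\<dots> = (\<Prod>i\<in>{..<m} - {0}. f i)" by (simp add: g_def)
      finally have "(\<Prod>i\<in>{..<m} - {0}. f i) = g 0 * (\<Prod>k\<in>J. g k * g (m - k))"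
        unfolding prod.reflect_pairs[OF assms(1), of g] J_def by simp
      also have "\<dots> = (\<Prod>k\<in>J. f k * f (m - k))"
        using pair_range unfolding J_def by (auto simp: g_def intro!: prod.cong)
      finally show ?thesis .
    qed
    then show ?thesis unfolding R_def B by simp
  qed
  have Rk: "z ^ (m - 1) * (R j + R (m - j)) = (z\<^sup>2 - 2 * z * of_real (cosh h) + 1) *
      ((of_real (a1 m h j) * z\<^sup>2 + of_real (a2 m h j) * z + of_real (a1 m h j)) *
       (\<Prod>k\<in>J - {j}. poly (quartic m h k) z))" if j: "j \<in> J" for j
  proof -
    have jm: "0 < j" "j < m" using j pair_range unfolding J_def by auto
    define Q where "Q = (\<Prod>k\<in>J - {j}. f k * f (m - k))"
    have Rj: "R j = weight m h j * (f 0 * (f (m - j) * Q))"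
      unfolding R_def Q_def using j unfolding J_def
      by (intro arg_cong2[of _ _ _ _ "(*)"] prod.reflect_pairs_remove assms refl) auto
    have Rmj: "R (m - j) = weight m h (m - j) * (f 0 * (f j * Q))"
      unfolding R_def Q_def using j unfolding J_def
      by (intro arg_cong2[of _ _ _ _ "(*)"] prod.reflect_pairs_remove assms refl) auto
    have "z * (weight m h j * f (m - j) + weight m h (m - j) * f j)
       = (weight m h j + weight m h (m - j)) * (z * (z + 1 / z))
         - z * (weight m h j * node m h (m - j) + weight m h (m - j) * node m h j)"
      unfolding f_def by (simp only: ring_distribs mult_ac)
        (simp add: algebra_simps)
    also have "z * (z + 1 / z) = z\<^sup>2 + 1" using assms(2) by (simp add: field_simps power2_eq_square)
    finally have num: "z * (weight m h j * f (m - j) + weight m h (m - j) * f j)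
       = of_real (a1 m h j) * z\<^sup>2 + of_real (a2 m h j) * z + of_real (a1 m h j)"
      unfolding weight_pair_sum[OF jm] weight_node_pair_sum[OF jm] by (simp add: algebra_simps)
    have z: "z ^ (m - 1) = z\<^sup>2 * (\<Prod>k\<in>J - {j}. z\<^sup>2)"
      unfolding zm using j by (intro prod.remove) (auto simp: J_def)
    have X: "(\<Prod>k\<in>J - {j}. poly (quartic m h k) z) = (\<Prod>k\<in>J - {j}. z\<^sup>2) * Q"
      unfolding Q_def using quart by (simp add: prod.distrib)
    have Y: "z ^ (m - 1) * (R j + R (m - j)) = (z * f 0) *
        (z * (weight m h j * f (m - j) + weight m h (m - j) * f j) * ((\<Prod>k\<in>J - {j}. z\<^sup>2) * Q))"
      unfolding z Rj Rmj by (simp add: algebra_simps power2_eq_square)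
    have c: "z\<^sup>2 - 2 * z * of_real (cosh h) + 1 = z * f 0"
      unfolding f_def by (rule central_quadratic_joukowski[OF assms(2)])
    show ?thesis unfolding Y num X c ..
  qed
  have "poly (reduced_P m h) (z + 1 / z) = 1 / of_real (K m h) * (\<Sum>n<m. R n)"
    unfolding reduced_P_def R_def f_def by (simp add: poly_sum poly_prod)
  also have "(\<Sum>n<m. R n) = R 0 + (\<Sum>k\<in>J. R k + R (m - k))"
    unfolding J_def by (rule sum.reflect_pairs[OF assms(1)])
  finally have "z ^ (m - 1) * poly (reduced_P m h) (z + 1 / z)
      = 1 / of_real (K m h) * (z ^ (m - 1) * R 0 + (\<Sum>k\<in>J. z ^ (m - 1) * (R k + R (m - k))))"
    by (simp add: algebra_simps sum_distrib_left)
  also have "\<dots> = poly (P_poly m h) z"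
  proof -
    have quad: "poly [:1, of_real (- 2 * cosh h), 1:] z = z\<^sup>2 - 2 * z * of_real (cosh h) + 1"
      by (simp add: algebra_simps power2_eq_square)
    have num: "poly [:of_real (a1 m h j), of_real (a2 m h j), of_real (a1 m h j):] z
        = of_real (a1 m h j) * z\<^sup>2 + of_real (a2 m h j) * z + of_real (a1 m h j)" for j
      by (simp add: algebra_simps power2_eq_square)
    have S: "(\<Sum>k\<in>J. z ^ (m - 1) * (R k + R (m - k))) = (z\<^sup>2 - 2 * z * of_real (cosh h) + 1) *
      (\<Sum>j\<in>J. (of_real (a1 m h j) * z\<^sup>2 + of_real (a2 m h j) * z + of_real (a1 m h j)) *
       (\<Prod>k\<in>J - {j}. poly (quartic m h k) z))"
      unfolding sum_distrib_left using Rk by (intro sum.cong refl) auto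
    show ?thesis
      unfolding P_poly_def poly_smult poly_add poly_mult poly_sum poly_prod quad num J_def[symmetric]
        R0 S by simp
  qed
  finally show ?thesis ..
qed

lemma poly_P_poly_0:
  assumes "K m h \<noteq> 0"
  shows "poly (P_poly m h) 0 = 1"
proof -
  have "poly (P_poly m h) 0 = of_real (1 / K m h) * of_real (K m h)"
    unfolding P_poly_def by (simp add: poly_sum poly_prod B_poly_def quartic_def K_def)
  then show ?thesis using assms by (simp flip: of_real_mult)
qed

text \<open>
  The index \<open>m - n\<close> turns \<open>- \<omega> exp (- x \<omega>)\<close> into the complex conjugate of \<open>\<omega> exp (x \<omega>)\<close>, so the sum
  of the hyperbolic sines picks out real parts of \<open>\<omega> exp (x \<omega>)\<close>.
\<close>

lemma G_fun_eq_sinh_sum: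
  assumes "m > 0"
  shows "complex_of_real (G_fun m x)
    = of_real (sgn x / (2 * real m)) * (\<Sum>n<m. unity_root m n * sinh (of_real x * unity_root m n))"
proof -
  define e where "e = (\<lambda>n. unity_root m n * exp (of_real x * unity_root m n))"
  have reflected: "unity_root m (m - n) * exp (- (of_real x * unity_root m (m - n))) = - cnj (e n)"
    if "n \<in> {1..m - 1}" for n
  proof -
    have "0 < n" "n < m" using that by auto
    from unity_root_reflect[OF this] show ?thesis by (simp add: e_def exp_cnj)
  qed
  have Re_e: "of_real (exp (x * cos (pi * real n / real m)) *
        cos (x * sin (pi * real n / real m) + pi * real n / real m)) = (e n + cnj (e n)) / 2" for n
    by (simp add: e_def unity_root_def complex_eq_iff Re_exp Im_exp cos_add algebra_simps)
  have "(\<Sum>n<m. unity_root m n * sinh (of_real x * unity_root m n))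
      = sinh (of_real x) + (\<Sum>n=1..m - 1. unity_root m n * sinh (of_real x * unity_root m n))"
  proof -
    have "{..<m} = insert 0 {1..m - 1}" using assms by auto
    then show ?thesis by simp
  qed
  also have "(\<Sum>n=1..m - 1. unity_root m n * sinh (of_real x * unity_root m n))
     = (\<Sum>n=1..m - 1. e n / 2)
       - (\<Sum>n=1..m - 1. unity_root m n * exp (- (of_real x * unity_root m n)) / 2)"
    unfolding sum_subtractf[symmetric] e_def
    by (rule sum.cong[OF refl]) (simp add: sinh_field_def right_diff_distrib diff_divide_distrib)
  also have "(\<Sum>n=1..m - 1. unity_root m n * exp (- (of_real x * unity_root m n)) / 2)
     = (\<Sum>n=1..m - 1. - cnj (e n) / 2)"
  proof (rule sum.reindex_bij_witness[of _ "\<lambda>n. m - n" "\<lambda>n. m - n"])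
    fix n assume n: "n \<in> {1..m - 1}"
    then have "m - n \<in> {1..m - 1}" "m - (m - n) = n" by auto
    from reflected[OF this(1), unfolded this(2)]
    show "- cnj (e (m - n)) / 2 = unity_root m n * exp (- (of_real x * unity_root m n)) / 2"
      by simp
  qed auto
  also have "(\<Sum>n=1..m - 1. e n / 2) - (\<Sum>n=1..m - 1. - cnj (e n) / 2)
     = (\<Sum>n=1..m - 1. of_real (exp (x * cos (pi * real n / real m)) *
        cos (x * sin (pi * real n / real m) + pi * real n / real m)))"
    unfolding Re_e sum_subtractf[symmetric] by (intro sum.cong refl) (simp add: field_simps)
  also have "sinh (complex_of_real x) = of_real (sinh x)"
    by (simp add: sinh_field_def flip: exp_of_real)
  finally show ?thesis unfolding G_fun_def by simp
qed

lemma G_grid_eq_exp_sum: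
  assumes "m > 0" and "h > 0"
  defines "u \<equiv> \<lambda>n. exp (of_real h * unity_root m n)"
  shows "G_grid m h \<beta> = (\<Sum>n<m. unity_root m n / (4 * of_nat m) *
     (u n ^ nat \<bar>\<beta>\<bar> - (1 / u n) ^ nat \<bar>\<beta>\<bar>))"
proof -
  have sinh_term: "of_real (sgn (h * real_of_int \<beta>)) * sinh (of_real (h * real_of_int \<beta>) * unity_root m n)
      = (u n ^ nat \<bar>\<beta>\<bar> - (1 / u n) ^ nat \<bar>\<beta>\<bar>) / 2" for n
  proof -
    define b where "b = nat \<bar>\<beta>\<bar>"
    define y where "y = of_real h * unity_root m n"
    have "exp (of_nat b * y) = exp y ^ b" "exp (- (of_nat b * y)) = (1 / exp y) ^ b"
      by (simp_all add: exp_of_nat_mult exp_minus power_divide inverse_eq_divide)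
    then have s: "sinh (of_nat b * y) = (u n ^ b - (1 / u n) ^ b) / 2"
      by (simp add: sinh_field_def u_def y_def)
    consider "\<beta> = 0" | "\<beta> > 0" | "\<beta> < 0" by linarith
    then show ?thesis
    proof cases
      case 1
      then show ?thesis by simp
    next
      case 2
      then have "of_real (h * real_of_int \<beta>) * unity_root m n = of_nat b * y"
        by (simp add: b_def y_def)
      then show ?thesis unfolding b_def[symmetric] using 2 assms(2) s by (simp add: sgn_mult)
    next
      case 3
      then have "of_real (h * real_of_int \<beta>) * unity_root m n = - (of_nat b * y)"
        by (simp add: b_def y_def)
      then show ?thesis unfolding b_def[symmetric] using 3 assms(2) s by (simp add: sgn_mult)
    qed
  qed
  have "G_grid m h \<beta> = (\<Sum>n<m. unity_root m n / (2 * of_nat m) *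
      (of_real (sgn (h * real_of_int \<beta>)) * sinh (of_real (h * real_of_int \<beta>) * unity_root m n)))"
    unfolding G_grid_def G_fun_eq_sinh_sum[OF assms(1)] by (simp add: sum_distrib_left mult_ac)
  then show ?thesis unfolding sinh_term by simp
qed

section \<open>Partial fractions with simple poles\<close>

text \<open>
  The second highest coefficient is read off from \<open>pCons 0\<close> of the product so that the statement
  remains true, with value \<open>0\<close>, for the empty product; this is the case \<open>m = 1\<close> below.
\<close>

lemma coeff_prod_linear:
  fixes a :: "'i \<Rightarrow> complex"
  assumes "finite I"
  shows "degree (\<Prod>i\<in>I. [:- a i, 1:]) = card I"
    and "coeff (\<Prod>i\<in>I. [:- a i, 1:]) (card I) = 1"
    and "coeff (pCons 0 (\<Prod>i\<in>I. [:- a i, 1:])) (card I) = - (\<Sum>i\<in>I. a i)"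
proof -
  show deg: "degree (\<Prod>i\<in>J. [:- a i, 1:]) = card J" for J
    by (cases "finite J") (simp_all add: degree_prod_eq_sum_degree)
  show lead: "coeff (\<Prod>i\<in>J. [:- a i, 1:]) (card J) = 1" for J
    using lead_coeff_prod[of "\<lambda>i. [:- a i, 1:]" J] by (simp add: deg)
  show "coeff (pCons 0 (\<Prod>i\<in>I. [:- a i, 1:])) (card I) = - (\<Sum>i\<in>I. a i)"
    using assms
  proof (induction I rule: finite_induct)
    case (insert i I)
    then show ?case using lead[of I] by simp
  qed simp
qed

lemma poly_pderiv_prod_linear:
  fixes W :: "complex set"
  assumes "finite W" and "w \<in> W"
  shows "poly (pderiv (\<Prod>v\<in>W. [:- v, 1:])) w = (\<Prod>v\<in>W - {w}. w - v)"
proof -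
  have "poly (pderiv (\<Prod>v\<in>W. [:- v, 1:])) w = (\<Sum>v\<in>W. \<Prod>x\<in>W - {v}. w - x)"
    by (simp add: pderiv_prod pderiv_pCons poly_sum poly_prod)
  also have "\<dots> = (\<Prod>x\<in>W - {w}. w - x) + (\<Sum>v\<in>W - {w}. \<Prod>x\<in>W - {v}. w - x)"
    using assms by (rule sum.remove)
  also have "(\<Sum>v\<in>W - {w}. \<Prod>x\<in>W - {v}. w - x) = 0"
    using assms by (intro sum.neutral ballI prod_zero) auto
  finally show ?thesis by simp
qed

text \<open>
  Subtracting \<open>(X + c) p\<close> from \<open>q\<close> removes the coefficients of the two highest degrees, and what
  remains has degree below \<open>card W\<close> and is given by its Lagrange interpolant at the roots of \<open>p\<close>.
\<close>

lemma partial_fractions: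
  fixes W :: "complex set" and q :: "complex poly"
  assumes "finite W"
  defines "p \<equiv> \<Prod>v\<in>W. [:- v, 1:]"
  assumes deg: "degree q \<le> Suc (card W)" and lead: "coeff q (Suc (card W)) = 1"
    and second: "coeff q (card W) = coeff (pCons 0 p) (card W) + c"
    and u: "u \<notin> W"
  shows "poly q u / poly p u = u + c + (\<Sum>w\<in>W. poly q w / (poly (pderiv p) w * (u - w)))"
proof -
  define T where "T = q - [:c, 1:] * p"
  define R where "R = (\<lambda>w. \<Prod>v\<in>W - {w}. [:- v, 1:])"
  define L where "L = (\<Sum>w\<in>W. smult (poly q w / poly (pderiv p) w) (R w))"
  have p: "degree p = card W" "coeff p (card W) = 1"
    unfolding p_def using coeff_prod_linear(1,2)[OF assms(1), of "\<lambda>v. v"] by simp_all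
  have T0: "coeff T i = 0" if "i \<ge> card W" for i
  proof -
    have step: "coeff T i = coeff q i - (c * coeff p i + coeff (pCons 0 p) i)"
      unfolding T_def by simp
    consider "i = card W" | "i = Suc (card W)" | "i > Suc (card W)"
      using \<open>i \<ge> card W\<close> by linarith
    then show ?thesis
    proof cases
      case 1
      then show ?thesis using step second p by simp
    next
      case 2
      then show ?thesis using step lead p by (simp add: coeff_eq_0)
    next
      case 3
      then show ?thesis using step deg p by (cases i) (auto simp: coeff_eq_0)
    qed
  qed
  have root: "poly p w = 0" if "w \<in> W" for w
    using that assms(1) unfolding p_def poly_prod by (intro prod_zero) auto
  have R_ne: "poly (R w) x = 0" if "w \<in> W" "x \<in> W" "x \<noteq> w" for w x
    using that assms(1) unfolding R_def poly_prod by (intro prod_zero) auto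
  have dp: "poly (pderiv p) w = poly (R w) w" "poly (pderiv p) w \<noteq> 0" if "w \<in> W" for w
    using poly_pderiv_prod_linear[OF assms(1) that] assms(1)
    unfolding p_def R_def poly_prod by auto
  have "T = L"
  proof (cases "W = {}")
    case True
    then have "T = 0" using T0 by (intro poly_eqI) simp
    then show ?thesis using True by (simp add: L_def)
  next
    case False
    then have pos: "card W > 0" using assms(1) by (simp add: card_gt_0_iff)
    show ?thesis
    proof (rule poly_eqI_degree[where A = W])
      fix x assume x: "x \<in> W"
      have "poly L x = (\<Sum>w\<in>W. poly q w / poly (pderiv p) w * poly (R w) x)"
        unfolding L_def by (simp add: poly_sum)
      also have "\<dots> = (\<Sum>w\<in>W. if w = x then poly q x else 0)"
        using x R_ne dp by (intro sum.cong refl) auto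
      also have "\<dots> = poly q x" using x assms(1) by simp
      finally show "poly T x = poly L x" using root[OF x] by (simp add: T_def)
    next
      show "degree T < card W"
        using T0 pos by (meson degree_lessI not_le)
    next
      have "degree L \<le> card W - 1"
        unfolding L_def
      proof (rule degree_sum_le)
        fix w assume "w \<in> W"
        then have "degree (R w) = card W - 1"
          unfolding R_def using coeff_prod_linear(1)[of "W - {w}" "\<lambda>v. v"] assms(1) by simp
        then show "degree (smult (poly q w / poly (pderiv p) w) (R w)) \<le> card W - 1" by simp
      qed (rule assms(1))
      then show "degree L < card W" using pos by simp
    qed
  qed
  have pu: "poly p u \<noteq> 0" using u assms(1) unfolding p_def poly_prod by auto
  have "poly (R w) u = poly p u / (u - w)" if "w \<in> W" for w
  proof -
    have "poly p u = (u - w) * poly (R w) u"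
      unfolding p_def R_def poly_prod
      using prod.remove[OF assms(1) that, of "\<lambda>v. poly [:- v, 1:] u"] by simp
    moreover have "u \<noteq> w" using u that by auto
    ultimately show ?thesis by simp
  qed
  then have "poly L u = (\<Sum>w\<in>W. poly q w / poly (pderiv p) w * (poly p u / (u - w)))"
    unfolding L_def by (simp add: poly_sum)
  also have "\<dots> = poly p u * (\<Sum>w\<in>W. poly q w / (poly (pderiv p) w * (u - w)))"
    by (simp add: sum_distrib_left mult_ac)
  finally have "poly q u = (u + c) * poly p u
      + poly p u * (\<Sum>w\<in>W. poly q w / (poly (pderiv p) w * (u - w)))"
    using \<open>T = L\<close> unfolding T_def by (simp add: algebra_simps flip: \<open>T = L\<close>)
  then show ?thesis using pu by (simp add: field_simps)
qed

section \<open>Sign alternation of the derivatives of the logistic function\<close>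

text \<open>
  If \<open>\<phi>' = \<phi> (1 + \<phi>)\<close>, then the \<open>k\<close>-th derivative of \<open>\<phi>\<close> is the \<open>k\<close>-th of these polynomials evaluated
  at \<open>\<phi>\<close>. The sign changes of derivatives of the logistic function thus become a question about
  polynomials on the bounded interval \<open>(-1/2, 0)\<close>.
\<close>

primrec logistic_poly :: "nat \<Rightarrow> real poly" where
  "logistic_poly 0 = [:0, 1:]"
| "logistic_poly (Suc k) = [:0, 1, 1:] * pderiv (logistic_poly k)"

declare logistic_poly.simps(2) [simp del]

lemma logistic_poly_0 [simp]: "poly (logistic_poly k) 0 = 0"
  by (cases k) (simp_all add: logistic_poly.simps(2))

text \<open>
  The substitution \<open>v \<mapsto> -1 - v\<close> preserves \<open>v (1 + v)\<close> and reverses the sign of a derivative.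
\<close>

lemma logistic_poly_reflect:
  "pcompose (logistic_poly (Suc k)) [:-1, -1:] = smult ((-1) ^ k) (logistic_poly (Suc k))"
proof (induction k)
  case 0
  show ?case by (simp add: logistic_poly.simps(2) pderiv_pCons pcompose_pCons)
next
  case (Suc k)
  define r where "r = logistic_poly (Suc k)"
  have "pderiv (pcompose r [:-1, -1:]) = pcompose (pderiv r) [:-1, -1:] * [:-1:]"
    by (simp add: pderiv_pcompose pderiv_pCons)
  also have "pderiv (pcompose r [:-1, -1:]) = smult ((-1) ^ k) (pderiv r)"
    unfolding r_def Suc.IH by (rule pderiv_smult)
  finally have d: "pcompose (pderiv r) [:-1, -1:] = smult ((-1) ^ Suc k) (pderiv r)"
    by simp
  have "pcompose (logistic_poly (Suc (Suc k))) [:-1, -1:]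
      = pcompose [:0, 1, 1:] [:-1, -1:] * pcompose (pderiv r) [:-1, -1:]"
    by (simp only: logistic_poly.simps(2)[of "Suc k"] r_def pcompose_mult)
  also have "pcompose [:0, 1, 1:] [:-1, -1:] = [:0, 1, 1 :: real:]"
    by (simp add: pcompose_pCons)
  finally show ?case
    unfolding d by (simp only: logistic_poly.simps(2)[of "Suc k"] r_def mult_smult_right)
qed

lemma logistic_poly_midpoint:
  assumes "odd k"
  shows "poly (logistic_poly (Suc k)) (- 1 / 2) = 0"
proof -
  have "poly (pcompose (logistic_poly (Suc k)) [:-1, -1:]) (- 1 / 2)
      = - poly (logistic_poly (Suc k)) (- 1 / 2)"
    unfolding logistic_poly_reflect using assms by simp
  then show ?thesis by (simp add: poly_pcompose)
qed

text \<open>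
  The points decrease from \<open>t 0 = 0\<close> and stay above \<open>-1/2\<close>; the sign condition concerns \<open>t 1, \<dots>, t N\<close>
  only, as \<open>t 0\<close> is kept for the zero of \<open>f\<close> at \<open>0\<close>.
\<close>

definition alternates :: "nat \<Rightarrow> (real \<Rightarrow> real) \<Rightarrow> (nat \<Rightarrow> real) \<Rightarrow> bool" where
  "alternates N f t \<longleftrightarrow> t 0 = 0 \<and> (\<forall>i<N. t (Suc i) < t i \<and> - 1 / 2 < t (Suc i) \<and>
     0 < (- 1) ^ Suc i * f (t (Suc i)))"

text \<open>
  The mean value theorem on every interval between consecutive points. The factor \<open>v (1 + v)\<close> is
  negative on \<open>(-1/2, 0)\<close>, so passing from \<open>pderiv p\<close> to its product with this factor flips all signs
  and the product is again negative at the first new point.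
\<close>

lemma rolle_alternation:
  fixes p :: "real poly" and t :: "nat \<Rightarrow> real"
  assumes dec: "\<And>i. i < N \<Longrightarrow> t (Suc i) < t i"
    and range: "\<And>i. i \<le> N \<Longrightarrow> - 1 / 2 \<le> t i \<and> t i \<le> 0"
    and alt: "\<And>i. i < N \<Longrightarrow> 0 < (- 1) ^ Suc i * (poly p (t (Suc i)) - poly p (t i))"
  shows "\<exists>s. alternates N (poly ([:0, 1, 1:] * pderiv p)) s"
proof -
  have "\<exists>x. t (Suc i) < x \<and> x < t i \<and> 0 < (- 1) ^ Suc i * poly ([:0, 1, 1:] * pderiv p) x"
    if i: "i < N" for i
  proof -
    obtain x where x: "t (Suc i) < x" "x < t i"
      and mvt: "poly p (t i) - poly p (t (Suc i)) = (t i - t (Suc i)) * poly (pderiv p) x"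
      using poly_MVT[OF dec[OF i], of p] by blast
    have "(- 1) ^ Suc i * (poly p (t (Suc i)) - poly p (t i))
        = - ((- 1) ^ Suc i * (poly p (t i) - poly p (t (Suc i))))" by (simp add: algebra_simps)
    then have "0 < (t i - t (Suc i)) * (- ((- 1) ^ Suc i * poly (pderiv p) x))"
      using alt[OF i] unfolding mvt by (simp add: algebra_simps)
    then have 1: "0 < - ((- 1) ^ Suc i * poly (pderiv p) x)"
      using dec[OF i] by (simp only: zero_less_mult_iff) linarith
    have 2: "0 < - (x * (1 + x))"
    proof -
      have "x < 0" "0 < 1 + x" using x range[of i] range[of "Suc i"] i by auto
      then show ?thesis by (simp add: mult_neg_pos)
    qed
    have eq: "(- 1) ^ Suc i * poly ([:0, 1, 1:] * pderiv p) x
        = - (x * (1 + x)) * - ((- 1) ^ Suc i * poly (pderiv p) x)"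
      by (simp add: algebra_simps)
    have "0 < (- 1) ^ Suc i * poly ([:0, 1, 1:] * pderiv p) x"
      unfolding eq by (rule mult_pos_pos[OF 2 1])
    with x show ?thesis by blast
  qed
  then obtain \<xi> where \<xi>: "\<And>i. i < N \<Longrightarrow> t (Suc i) < \<xi> i \<and> \<xi> i < t i \<and>
      0 < (- 1) ^ Suc i * poly ([:0, 1, 1:] * pderiv p) (\<xi> i)" by metis
  define s where "s = (\<lambda>i. case i of 0 \<Rightarrow> 0 | Suc j \<Rightarrow> \<xi> j)"
  have "s (Suc i) < s i \<and> - 1 / 2 < s (Suc i)" if i: "i < N" for i
  proof
    show "- 1 / 2 < s (Suc i)" using \<xi>[OF i] range[of "Suc i"] i by (auto simp: s_def)
    show "s (Suc i) < s i"
    proof (cases i)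
      case 0
      then show ?thesis using \<xi>[OF i] range[of 0] by (auto simp: s_def)
    next
      case (Suc j)
      then show ?thesis using \<xi>[OF i] \<xi>[of j] i by (auto simp: s_def)
    qed
  qed
  then have "alternates N (poly ([:0, 1, 1:] * pderiv p)) s"
    using \<xi> unfolding alternates_def by (auto simp: s_def)
  then show ?thesis by blast
qed

lemma alternates_range:
  assumes "alternates N f t" and "i \<le> N"
  shows "- 1 / 2 < t i \<and> t i \<le> 0"
  using assms(2)
proof (induction i)
  case 0
  then show ?case using assms(1) by (simp add: alternates_def)
next
  case (Suc i)
  then have "t (Suc i) < t i" "- 1 / 2 < t (Suc i)" "t i \<le> 0"
    using assms(1) by (auto simp: alternates_def)
  then show ?case by linarith
qed

lemma alternates_increments:
  fixes f :: "real \<Rightarrow> real"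
  assumes "alternates N f t" and "f 0 = 0" and "i < N"
  shows "0 < (- 1) ^ Suc i * (f (t (Suc i)) - f (t i))"
proof (cases i)
  case 0
  then show ?thesis using assms unfolding alternates_def by auto
next
  case (Suc j)
  then have "0 < (- 1) ^ Suc i * f (t (Suc i))" "0 < (- 1) ^ i * f (t i)"
    using assms unfolding alternates_def by (auto dest: Suc_lessD)
  then show ?thesis by (simp add: algebra_simps)
qed

text \<open>
  The zero of \<open>p\<close> at \<open>0\<close> serves as the first point.
\<close>

lemma alternates_pderiv:
  fixes p :: "real poly"
  assumes "alternates N (poly p) t" and "poly p 0 = 0"
  shows "\<exists>s. alternates N (poly ([:0, 1, 1:] * pderiv p)) s"
proof (rule rolle_alternation[of N t p])
  show "t (Suc i) < t i" if "i < N" for i using assms(1) that by (simp add: alternates_def)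
  show "- 1 / 2 \<le> t i \<and> t i \<le> 0" if "i \<le> N" for i
    using alternates_range[OF assms(1) that] by auto
  show "0 < (- 1) ^ Suc i * (poly p (t (Suc i)) - poly p (t i))" if "i < N" for i
    using alternates_increments[OF assms that] .
qed

text \<open>
  A zero at the other end point \<open>-1/2\<close> yields one interval, hence one sign change, more.
\<close>

lemma alternates_pderiv_Suc:
  fixes p :: "real poly"
  assumes alt: "alternates N (poly p) t" and "N > 0" and "poly p 0 = 0" and "poly p (- 1 / 2) = 0"
  shows "\<exists>s. alternates (Suc N) (poly ([:0, 1, 1:] * pderiv p)) s"
proof -
  define s where "s = t(Suc N := - 1 / 2)"
  obtain M where M: "N = Suc M" using \<open>N > 0\<close> gr0_implies_Suc by blast
  show ?thesis
  proof (rule rolle_alternation[of "Suc N" s p])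
    show "s (Suc i) < s i" if "i < Suc N" for i
      using that alt alternates_range[OF alt, of N] by (auto simp: alternates_def s_def less_Suc_eq)
    show "- 1 / 2 \<le> s i \<and> s i \<le> 0" if "i \<le> Suc N" for i
      using that alternates_range[OF alt, of i] by (auto simp: s_def le_Suc_eq)
    show "0 < (- 1) ^ Suc i * (poly p (s (Suc i)) - poly p (s i))" if i: "i < Suc N" for i
    proof (cases "i = N")
      case True
      have "0 < (- 1) ^ N * poly p (t N)" using alt unfolding alternates_def M by blast
      then show ?thesis using True assms(4) by (simp add: s_def)
    next
      case False
      then have "i < N" using i by simp
      then show ?thesis using alternates_increments[OF alt assms(3), of i] False
        by (simp add: s_def)
    qed
  qed
qed

text \<open>
  Every second polynomial vanishes at \<open>-1/2\<close> by symmetry, so two differentiations gain one point.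
\<close>

lemma logistic_poly_alternates:
  "\<exists>t. alternates (Suc j) (poly (logistic_poly (Suc (2 * j)))) t"
proof (induction j)
  case 0
  show ?case
    by (rule exI[of _ "\<lambda>i. if i = 0 then 0 else - 1 / 4"]) (simp add: alternates_def logistic_poly.simps(2) pderiv_pCons)
next
  case (Suc j)
  then obtain t where "alternates (Suc j) (poly (logistic_poly (Suc (2 * j)))) t" ..
  from alternates_pderiv[OF this logistic_poly_0]
  obtain s where "alternates (Suc j) (poly (logistic_poly (Suc (Suc (2 * j))))) s"
    unfolding logistic_poly.simps(2)[of "Suc (2 * j)"] ..
  from alternates_pderiv_Suc[OF this _ logistic_poly_0 logistic_poly_midpoint]
  have "\<exists>s. alternates (Suc (Suc j)) (poly (logistic_poly (Suc (Suc (Suc (2 * j)))))) s"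
    unfolding logistic_poly.simps(2)[of "Suc (Suc (2 * j))"] by simp
  then show ?case by simp
qed

abbreviation complex_poly :: "real poly \<Rightarrow> complex poly" where
  "complex_poly \<equiv> map_poly of_real"

lemma poly_complex_poly_of_real: "poly (complex_poly p) (of_real x) = of_real (poly p x)"
  by (induction p) (simp_all add: map_poly_pCons)

lemma complex_poly_logistic_step:
  "complex_poly ([:0, 1, 1:] * pderiv p) = [:0, 1, 1:] * pderiv (complex_poly p)"
  by (rule poly_eqI) (simp add: coeff_map_poly coeff_pderiv coeff_pCons split: nat.split)

text \<open>
  Along a solution of the logistic equation the polynomials are the higher derivatives.
\<close>

lemma logistic_poly_has_field_derivative:
  fixes \<phi> :: "complex \<Rightarrow> complex"
  assumes "(\<phi> has_field_derivative \<phi> u * (1 + \<phi> u)) (at u within S)"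
  shows "((\<lambda>u. poly (complex_poly (logistic_poly k)) (\<phi> u)) has_field_derivative
     poly (complex_poly (logistic_poly (Suc k))) (\<phi> u)) (at u within S)"
proof -
  have "((\<lambda>u. poly (complex_poly (logistic_poly k)) (\<phi> u)) has_field_derivative
      poly (pderiv (complex_poly (logistic_poly k))) (\<phi> u) * (\<phi> u * (1 + \<phi> u))) (at u within S)"
    by (rule DERIV_chain2[OF poly_DERIV assms])
  moreover have "poly (complex_poly (logistic_poly (Suc k))) (\<phi> u)
      = poly (pderiv (complex_poly (logistic_poly k))) (\<phi> u) * (\<phi> u * (1 + \<phi> u))"
    unfolding logistic_poly.simps(2) complex_poly_logistic_step by (simp add: algebra_simps)
  ultimately show ?thesis by simp
qed

section \<open>Averages over roots of unity\<close>

lemma unity_root_power_sum: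
  assumes "m > 0" and "k > 0" and "k \<le> 2 * m"
  shows "(\<Sum>n<2 * m. unity_root m n ^ k) = (if k = 2 * m then 2 * of_nat m else 0)"
proof -
  define \<zeta> where "\<zeta> = cis (pi * real k / real m)"
  have pow: "unity_root m n ^ k = \<zeta> ^ n" for n
    unfolding unity_root_def \<zeta>_def Complex.DeMoivre by (simp add: mult_ac)
  have one: "\<zeta> ^ (2 * m) = 1"
  proof -
    have "real (2 * m) * (pi * real k / real m) = 2 * pi * real k"
      using assms(1) by simp
    then show ?thesis unfolding \<zeta>_def Complex.DeMoivre by (simp add: cis_multiple_2pi)
  qed
  show ?thesis
  proof (cases "k = 2 * m")
    case True
    then have "pi * real k / real m = 2 * pi" using assms(1) by simp
    then have "\<zeta> = 1" by (simp only: \<zeta>_def cis_2pi)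
    then show ?thesis unfolding pow using True by simp
  next
    case False
    have "\<zeta> \<noteq> 1"
    proof
      assume "\<zeta> = 1"
      then have "cos (pi * real k / real m) = 1" by (simp add: \<zeta>_def complex_eq_iff)
      then obtain j :: int where "pi * real k / real m = real_of_int j * 2 * pi"
        unfolding cos_one_2pi_int by blast
      then have "real k = real_of_int j * 2 * real m" using assms(1) by (simp add: field_simps)
      then have "int k = j * (2 * int m)" by (metis mult.assoc of_int_eq_iff of_int_mult of_int_numeral of_int_of_nat_eq)
      moreover have "0 < int k" "int k < 2 * int m" using assms False by auto
      ultimately have "0 < j * (2 * int m)" "j * (2 * int m) < 1 * (2 * int m)" by auto
      then have "0 < j" "j < 1" using assms(1) by (simp_all add: zero_less_mult_iff)
      then show False by simp
    qed
    then show ?thesis unfolding pow using geometric_sum[OF \<open>\<zeta> \<noteq> 1\<close>, of "2 * m"] one False by simp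
  qed
qed

text \<open>
  By \<open>unity_root_power_sum\<close> the Taylor polynomial of degree \<open>2m - 1\<close> contributes its top term only,
  and the remainder is \<open>O(h\<^bsup>2m\<^esup>)\<close>. The functions \<open>f i\<close> are the successive derivatives of \<open>f 0\<close>.
\<close>

lemma unity_root_average_limit:
  fixes f :: "nat \<Rightarrow> complex \<Rightarrow> complex"
  assumes m: "m > 0" and e: "e > 0"
    and der: "\<And>i u. u \<in> ball 0 e \<Longrightarrow> (f i has_field_derivative f (Suc i) u) (at u)"
  defines "N \<equiv> 2 * m - 1"
  shows "((\<lambda>h::real. (\<Sum>n<2 * m. unity_root m n * f 0 (of_real h * unity_root m n)) / of_real h ^ N)
     \<longlongrightarrow> 2 * of_nat m * f N 0 / fact N) (at_right 0)"
proof -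
  have SN: "Suc N = 2 * m" using m by (simp add: N_def)
  have "isCont (f (Suc N)) 0" using der[of 0] e by (intro DERIV_isCont) auto
  then have "eventually (\<lambda>u. dist (f (Suc N) u) (f (Suc N) 0) < 1) (nhds 0)"
    unfolding isCont_def tendsto_iff
    by (intro eventually_nhds_conv_at[THEN iffD2]) auto
  then obtain r0 where r0: "r0 > 0" "\<And>u. dist u 0 < r0 \<Longrightarrow> dist (f (Suc N) u) (f (Suc N) 0) < 1"
    unfolding eventually_nhds_metric by blast
  define r where "r = min r0 e"
  define B where "B = norm (f (Suc N) 0) + 1"
  have r: "r > 0" using r0 e by (simp add: r_def)
  have B: "norm (f (Suc N) u) \<le> B" if "u \<in> ball 0 r" for u
  proof -
    have "dist (f (Suc N) u) (f (Suc N) 0) < 1" using that r0(2)[of u] by (auto simp: r_def dist_commute)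
    then show ?thesis using norm_triangle_sub[of "f (Suc N) u" "f (Suc N) 0"]
      by (auto simp: B_def dist_norm)
  qed
  define S where "S = (\<lambda>h::real. \<Sum>n<2 * m. unity_root m n * f 0 (of_real h * unity_root m n))"
  define L where "L = 2 * of_nat m * f N 0 / fact N"
  have taylor_sum: "(\<Sum>n<2 * m. unity_root m n * (\<Sum>i\<le>N. f i 0 * (of_real h * unity_root m n) ^ i / fact i))
      = L * of_real h ^ N" for h :: real
  proof -
    have "(\<Sum>n<2 * m. unity_root m n * (\<Sum>i\<le>N. f i 0 * (of_real h * unity_root m n) ^ i / fact i))
       = (\<Sum>n<2 * m. \<Sum>i\<le>N. f i 0 * of_real h ^ i / fact i * unity_root m n ^ Suc i)"
      by (simp add: sum_distrib_left power_mult_distrib mult_ac)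
    also have "\<dots> = (\<Sum>i\<le>N. \<Sum>n<2 * m. f i 0 * of_real h ^ i / fact i * unity_root m n ^ Suc i)"
      by (rule sum.swap)
    also have "\<dots> = (\<Sum>i\<le>N. f i 0 * of_real h ^ i / fact i * (\<Sum>n<2 * m. unity_root m n ^ Suc i))"
      by (simp only: sum_distrib_left)
    also have "\<dots> = (\<Sum>i\<le>N. if i = N then L * of_real h ^ N else 0)"
    proof (rule sum.cong[OF refl])
      fix i assume "i \<in> {..N}"
      then have "Suc i \<le> 2 * m" "Suc i = 2 * m \<longleftrightarrow> i = N" using SN by auto
      then show "f i 0 * of_real h ^ i / fact i * (\<Sum>n<2 * m. unity_root m n ^ Suc i)
          = (if i = N then L * of_real h ^ N else 0)"
        using unity_root_power_sum[OF m, of "Suc i"] by (auto simp: L_def simp del: power_Suc)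
    qed
    finally show ?thesis by simp
  qed
  have bound: "norm (S h / of_real h ^ N - L) \<le> (2 * real m * B / fact N) * h"
    if h: "0 < h" "h < r" for h :: real
  proof -
    have each: "norm (f 0 (of_real h * unity_root m n) - (\<Sum>i\<le>N. f i 0 * (of_real h * unity_root m n) ^ i / fact i))
        \<le> B * h ^ Suc N / fact N" for n
    proof -
      have nz: "norm (of_real h * unity_root m n) = h"
        using h by (simp add: norm_mult unity_root_def)
      have "norm (f 0 (of_real h * unity_root m n) - (\<Sum>i\<le>N. f i 0 * (of_real h * unity_root m n - 0) ^ i / fact i))
        \<le> B * norm (of_real h * unity_root m n - 0) ^ Suc N / fact N"
      proof (rule complex_Taylor[where S = "ball 0 r"])
        show "(f i has_field_derivative f (Suc i) x) (at x within ball 0 r)" if "x \<in> ball 0 r" for i x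
          using that der[of x i] by (auto simp: r_def intro: has_field_derivative_at_within)
      qed (use r h nz B in auto)
      then show ?thesis using nz by simp
    qed
    have "norm (S h - L * of_real h ^ N) = norm (\<Sum>n<2 * m. unity_root m n *
       (f 0 (of_real h * unity_root m n) - (\<Sum>i\<le>N. f i 0 * (of_real h * unity_root m n) ^ i / fact i)))"
      unfolding S_def taylor_sum[symmetric] by (simp add: sum_subtractf right_diff_distrib)
    also have "\<dots> \<le> (\<Sum>n<2 * m. B * h ^ Suc N / fact N)"
      using each by (intro sum_norm_le) (simp add: norm_mult unity_root_def)
    also have "\<dots> = 2 * real m * B / fact N * h * h ^ N" by simp
    finally have "norm (S h - L * of_real h ^ N) / h ^ N \<le> 2 * real m * B / fact N * h"
      using h by (simp add: divide_le_eq)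
    moreover have "norm (S h / of_real h ^ N - L) = norm (S h - L * of_real h ^ N) / h ^ N"
    proof -
      have "S h / of_real h ^ N - L = (S h - L * of_real h ^ N) / of_real h ^ N"
        using h by (simp add: diff_divide_distrib)
      then show ?thesis using h by (simp add: norm_divide norm_power)
    qed
    ultimately show ?thesis by simp
  qed
  have "((\<lambda>h. S h / of_real h ^ N - L) \<longlongrightarrow> 0) (at_right 0)"
  proof (rule Lim_null_comparison)
    show "\<forall>\<^sub>F h in at_right 0. norm (S h / of_real h ^ N - L) \<le> (2 * real m * B / fact N) * h"
      unfolding eventually_at_right_field using bound r by blast
    show "((\<lambda>h::real. (2 * real m * B / fact N) * h) \<longlongrightarrow> 0) (at_right 0)"
      by (rule tendsto_eq_intros refl | simp)+
  qed
  then show ?thesis unfolding S_def L_def by (simp add: LIM_zero_iff)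
qed

section \<open>Location of the roots for small step size\<close>

text \<open>
  For \<open>\<bar>Im u\<bar> < \<pi>/2\<close> the exponential has positive real part, hence so has \<open>1 - x e\<^sup>u\<close>.
\<close>

lemma one_minus_neg_exp_nonzero:
  fixes u :: complex and x :: real
  assumes "x < 0" and "norm u < 1"
  shows "1 - of_real x * exp u \<noteq> 0"
proof -
  have "\<bar>Im u\<bar> < 1" using assms(2) abs_Im_le_cmod[of u] by linarith
  then have "0 < cos (Im u)" using pi_half_gt_zero pi_ge_two by (intro cos_gt_zero_pi) linarith+
  then have "x * (exp (Re u) * cos (Im u)) < 0" using assms(1) by (simp add: mult_neg_pos)
  then have "0 < Re (1 - of_real x * exp u)" by (simp add: Re_exp)
  then show ?thesis by (metis less_irrefl zero_complex.sel(1))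
qed

text \<open>
  The geometric series \<open>\<Sum>b\<ge>1. (x e\<^sup>u)\<^sup>b\<close> in closed form, that is, the generating function of the
  sequence \<open>e\<^bsup>ub\<^esup>\<close>. As a function of \<open>u\<close> it solves the logistic equation \<open>\<phi>' = \<phi> (1 + \<phi>)\<close>.
\<close>

definition geom_exp :: "real \<Rightarrow> complex \<Rightarrow> complex" where
  "geom_exp x u = of_real x * exp u / (1 - of_real x * exp u)"

lemma geom_exp_has_field_derivative:
  assumes "x < 0" and "norm u < 1"
  shows "(geom_exp x has_field_derivative geom_exp x u * (1 + geom_exp x u)) (at u)"
proof -
  note nz = one_minus_neg_exp_nonzero[OF assms]
  have "((\<lambda>u. of_real x * exp u / (1 - of_real x * exp u)) has_field_derivative
     (of_real x * exp u * (1 - of_real x * exp u) - of_real x * exp u * (- (of_real x * exp u)))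
      / ((1 - of_real x * exp u) * (1 - of_real x * exp u))) (at u)"
    using nz by (auto intro!: derivative_eq_intros)
  moreover have "(of_real x * exp u * (1 - of_real x * exp u) - of_real x * exp u * (- (of_real x * exp u)))
      / ((1 - of_real x * exp u) * (1 - of_real x * exp u)) = geom_exp x u * (1 + geom_exp x u)"
    using nz unfolding geom_exp_def by (simp add: divide_simps) (simp add: algebra_simps)
  ultimately show ?thesis unfolding geom_exp_def[abs_def] by simp
qed

lemma geom_exp_odd_part:
  assumes "x < 0" and "norm u < 1"
  shows "of_real (x + 1 / x) - 2 * cosh u \<noteq> 0"
    and "geom_exp x u - geom_exp x (- u) = 2 * sinh u / (of_real (x + 1 / x) - 2 * cosh u)"
proof -
  define X :: complex where "X = of_real x"
  define E where "E = exp u"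
  have nz: "X \<noteq> 0" "E \<noteq> 0" "1 - X * E \<noteq> 0" "1 - X / E \<noteq> 0"
    using assms one_minus_neg_exp_nonzero[of x u] one_minus_neg_exp_nonzero[of x "- u"]
    by (simp_all add: X_def E_def exp_minus field_simps)
  have den: "of_real (x + 1 / x) - 2 * cosh u = (1 - X * E) * (1 - X / E) / X"
    using nz(1,2) by (simp add: cosh_field_def exp_minus X_def[symmetric] E_def[symmetric] field_simps)
  then show "of_real (x + 1 / x) - 2 * cosh u \<noteq> 0" using nz by simp
  have "geom_exp x u - geom_exp x (- u) = X * E / (1 - X * E) - (X / E) / (1 - X / E)"
    by (simp add: geom_exp_def X_def E_def exp_minus divide_inverse)
  also have "\<dots> = (X * E * (1 - X / E) - (X / E) * (1 - X * E)) / ((1 - X * E) * (1 - X / E))"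
    using nz by (intro diff_frac_eq)
  also have "X * E * (1 - X / E) - (X / E) * (1 - X * E) = X * (E - 1 / E)"
    using nz by (simp add: field_simps)
  also have "E - 1 / E = 2 * sinh u"
    unfolding sinh_field_def E_def exp_minus by (simp add: inverse_eq_divide)
  finally show "geom_exp x u - geom_exp x (- u) = 2 * sinh u / (of_real (x + 1 / x) - 2 * cosh u)"
    unfolding den by simp
qed

text \<open>
  The second half of the \<open>2m\<close>-th roots of unity consists of the negatives of the first half.
\<close>

lemma sum_unity_root_double:
  assumes "m > 0"
  shows "(\<Sum>n<2 * m. unity_root m n * g (unity_root m n))
     = (\<Sum>n<m. unity_root m n * (g (unity_root m n) - g (- unity_root m n)))"
proof -
  have shift: "unity_root m (n + m) = - unity_root m n" for n
  proof -
    have "pi * real (n + m) / real m = pi * real n / real m + pi"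
      using assms by (simp add: field_simps)
    then show ?thesis by (simp add: unity_root_def complex_eq_iff)
  qed
  have "(\<Sum>n<2 * m. unity_root m n * g (unity_root m n))
     = (\<Sum>n<m. unity_root m n * g (unity_root m n))
       + (\<Sum>n<m. unity_root m (n + m) * g (unity_root m (n + m)))"
  proof -
    have "(\<Sum>n<m + k. f n) = (\<Sum>n<m. f n) + (\<Sum>n<k. f (n + m))" for f :: "nat \<Rightarrow> complex" and k
      by (induction k) (simp_all add: add_ac)
    then show ?thesis unfolding mult_2 .
  qed
  then show ?thesis by (simp add: shift sum_subtractf right_diff_distrib sum_negf)
qed

lemma K_eq_exp_average:
  assumes "odd m"
  shows "(\<Sum>n<2 * m. unity_root m n * exp (of_real h * unity_root m n)) = 2 * of_real (K m h)"
proof -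
  have "(\<Sum>n<2 * m. unity_root m n * exp (of_real h * unity_root m n))
    = (\<Sum>n<m. unity_root m n * (exp (of_real h * unity_root m n) - exp (of_real h * - unity_root m n)))"
    using assms by (intro sum_unity_root_double odd_pos)
  also have "\<dots> = (\<Sum>n<m. 2 * weight m h n)"
    by (rule sum.cong[OF refl]) (simp add: weight_def sinh_field_def)
  finally show ?thesis unfolding K_eq_weight_sum[OF assms] by (simp add: sum_distrib_left)
qed

lemma poly_reduced_P_weights:
  assumes "K m h \<noteq> 0" and "\<And>n. n < m \<Longrightarrow> w \<noteq> node m h n"
  shows "of_real (K m h) * poly (reduced_P m h) w
    = poly (char_poly m h) w * (\<Sum>n<m. weight m h n / (w - node m h n))"
proof -
  have "of_real (K m h) * poly (reduced_P m h) w
     = (\<Sum>n<m. weight m h n * (\<Prod>i\<in>{..<m} - {n}. w - node m h i))"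
    using assms(1) by (simp add: reduced_P_def poly_sum poly_prod)
  also have "\<dots> = (\<Sum>n<m. poly (char_poly m h) w * (weight m h n / (w - node m h n)))"
  proof (rule sum.cong[OF refl])
    fix n assume n: "n \<in> {..<m}"
    have "poly (char_poly m h) w = (w - node m h n) * (\<Prod>i\<in>{..<m} - {n}. w - node m h i)"
      unfolding char_poly_def poly_prod using prod.remove[OF _ n, of "\<lambda>i. w - node m h i"] by simp
    then show "weight m h n * (\<Prod>i\<in>{..<m} - {n}. w - node m h i)
        = poly (char_poly m h) w * (weight m h n / (w - node m h n))"
      using assms(2)[of n] n by simp
  qed
  finally show ?thesis by (simp add: sum_distrib_left)
qed

lemma reduced_P_eq_geom_exp_average:
  assumes "odd m" and "0 < h" and "h < 1" and "x < 0" and "K m h \<noteq> 0"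
  shows "2 * of_real (K m h) * poly (reduced_P m h) (of_real (x + 1 / x))
    = poly (char_poly m h) (of_real (x + 1 / x))
      * (\<Sum>n<2 * m. unity_root m n * geom_exp x (of_real h * unity_root m n))"
proof -
  have small: "norm (of_real h * unity_root m n) < 1" for n
    using assms by (simp add: norm_mult)
  note geom_exp = geom_exp_odd_part[OF assms(4) small]
  have "(\<Sum>n<2 * m. unity_root m n * geom_exp x (of_real h * unity_root m n))
    = (\<Sum>n<m. unity_root m n * (geom_exp x (of_real h * unity_root m n) - geom_exp x (of_real h * - unity_root m n)))"
    using assms(1) by (intro sum_unity_root_double odd_pos)
  also have "\<dots> = (\<Sum>n<m. 2 * (weight m h n / (of_real (x + 1 / x) - node m h n)))"
    using geom_exp(2) by (intro sum.cong refl) (simp add: weight_def node_def)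
  finally have "(\<Sum>n<2 * m. unity_root m n * geom_exp x (of_real h * unity_root m n))
    = 2 * (\<Sum>n<m. weight m h n / (of_real (x + 1 / x) - node m h n))"
    by (simp only: sum_distrib_left)
  moreover have "of_real (x + 1 / x) \<noteq> node m h n" for n
    using geom_exp(1)[of n] by (auto simp: node_def)
  ultimately show ?thesis
    using poly_reduced_P_weights[OF assms(5), of "of_real (x + 1 / x)"] by simp
qed

lemma exp_average_limit:
  assumes "odd m"
  shows "((\<lambda>h. 2 * of_real (K m h) / of_real h ^ (2 * m - 1))
     \<longlongrightarrow> (2 * of_nat m / fact (2 * m - 1) :: complex)) (at_right 0)"
proof -
  have "((\<lambda>h. (\<Sum>n<2 * m. unity_root m n * exp (of_real h * unity_root m n)) / of_real h ^ (2 * m - 1))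
     \<longlongrightarrow> 2 * of_nat m * exp 0 / fact (2 * m - 1)) (at_right 0)"
    by (rule unity_root_average_limit[where f = "\<lambda>_. exp" and e = 1])
      (use assms in \<open>auto simp: odd_pos intro: DERIV_exp\<close>)
  then show ?thesis unfolding K_eq_exp_average[OF assms] by (simp only: exp_zero mult_1_right)
qed

text \<open>
  \<open>K\<close> vanishes at \<open>h = 0\<close> to the exact order \<open>2m - 1\<close>.
\<close>

lemma K_eventually_nonzero:
  assumes "odd m"
  shows "\<forall>\<^sub>F h in at_right 0. K m h \<noteq> 0"
proof -
  have "\<forall>\<^sub>F h in at_right 0. 2 * of_real (K m h) / of_real h ^ (2 * m - 1) \<noteq> (0 :: complex)"
    using assms by (intro tendsto_imp_eventually_ne[OF exp_average_limit]) (auto simp: odd_pos)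
  then show ?thesis by (rule eventually_mono) auto
qed

text \<open>
  Both \<open>K\<close> and the average of \<open>geom_exp x\<close> are of order \<open>h\<^bsup>2m-1\<^esup>\<close>, and the powers of \<open>h\<close> cancel in their
  quotient. The substitution \<open>x = v / (1 + v)\<close> is chosen to make \<open>geom_exp x 0 = v\<close>; it maps
  \<open>(-1/2, 0)\<close> onto \<open>(-1, 0)\<close>.
\<close>

lemma P_poly_limit:
  assumes "odd m" and v: "- 1 < v" "v < 0"
  defines "x \<equiv> v / (1 + v)"
  shows "((\<lambda>h. poly (P_poly m h) (of_real x)) \<longlongrightarrow>
     of_real (x ^ (m - 1) * (x + 1 / x - 2) ^ m * poly (logistic_poly (2 * m - 1)) v)) (at_right 0)"
proof -
  have m: "m > 0" using assms(1) by (rule odd_pos)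
  define N where "N = 2 * m - 1"
  define w :: complex where "w = of_real (x + 1 / x)"
  have x: "x < 0" using v by (simp add: x_def divide_neg_pos)
  have f0: "geom_exp x 0 = of_real v"
  proof -
    have "x / (1 - x) = v" using v by (simp add: x_def field_simps)
    then have "complex_of_real (x / (1 - x)) = of_real v" by simp
    then show ?thesis by (simp add: geom_exp_def)
  qed
  define S where "S = (\<lambda>h::real. \<Sum>n<2 * m. unity_root m n * geom_exp x (of_real h * unity_root m n))"
  have S: "((\<lambda>h. S h / of_real h ^ N)
      \<longlongrightarrow> 2 * of_nat m * of_real (poly (logistic_poly N) v) / fact N) (at_right 0)"
  proof -
    have "((\<lambda>h::real. (\<Sum>n<2 * m. unity_root m n *
          poly (complex_poly (logistic_poly 0)) (geom_exp x (of_real h * unity_root m n))) / of_real h ^ N)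
       \<longlongrightarrow> 2 * of_nat m * poly (complex_poly (logistic_poly N)) (geom_exp x 0) / fact N) (at_right 0)"
      unfolding N_def
    proof (rule unity_root_average_limit[OF m, of 1
          "\<lambda>k u. poly (complex_poly (logistic_poly k)) (geom_exp x u)"])
      show "((\<lambda>u. poly (complex_poly (logistic_poly i)) (geom_exp x u)) has_field_derivative
          poly (complex_poly (logistic_poly (Suc i))) (geom_exp x u)) (at u)" if "u \<in> ball 0 1" for i u
        using that by (intro logistic_poly_has_field_derivative geom_exp_has_field_derivative x) auto
    qed simp
    then show ?thesis
      unfolding S_def f0 poly_complex_poly_of_real by (simp add: map_poly_pCons)
  qed
  have q: "((\<lambda>h. poly (char_poly m h) w) \<longlongrightarrow> (w - 2) ^ m) (at_right 0)"
  proof -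
    have "((\<lambda>h. \<Prod>n<m. w - node m h n) \<longlongrightarrow> (\<Prod>n<m. w - 2)) (at_right 0)"
    proof (rule tendsto_prod)
      fix n
      have "((\<lambda>h. w - node m h n) \<longlongrightarrow> w - 2 * ((exp (of_real 0 * unity_root m n) + exp (- (of_real 0 * unity_root m n))) / 2)) (at_right 0)"
        unfolding node_def cosh_field_def by (intro tendsto_intros) simp
      then show "((\<lambda>h. w - node m h n) \<longlongrightarrow> w - 2) (at_right 0)" by simp
    qed
    then show ?thesis by (simp add: char_poly_def poly_prod)
  qed
  note E = exp_average_limit[OF assms(1), folded N_def]
  have "((\<lambda>h. of_real x ^ (m - 1) * (poly (char_poly m h) w *
        ((S h / of_real h ^ N) / (2 * of_real (K m h) / of_real h ^ N))))
     \<longlongrightarrow> of_real x ^ (m - 1) * ((w - 2) ^ m *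
        ((2 * of_nat m * of_real (poly (logistic_poly N) v) / fact N) / (2 * of_nat m / fact N)))) (at_right 0)"
    using m by (intro tendsto_mult tendsto_const q tendsto_divide S E) simp
  also have "of_real x ^ (m - 1) * ((w - 2) ^ m *
        ((2 * of_nat m * of_real (poly (logistic_poly N) v) / fact N) / (2 * of_nat m / fact N)))
     = of_real (x ^ (m - 1) * (x + 1 / x - 2) ^ m * poly (logistic_poly N) v)"
    using m by (simp add: w_def)
  finally have lim: "((\<lambda>h. of_real x ^ (m - 1) * (poly (char_poly m h) w *
        ((S h / of_real h ^ N) / (2 * of_real (K m h) / of_real h ^ N)))) \<longlongrightarrow>
     of_real (x ^ (m - 1) * (x + 1 / x - 2) ^ m * poly (logistic_poly N) v)) (at_right 0)" .
  have "\<forall>\<^sub>F h in at_right 0. poly (P_poly m h) (of_real x) = of_real x ^ (m - 1) * (poly (char_poly m h) w *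
        ((S h / of_real h ^ N) / (2 * of_real (K m h) / of_real h ^ N)))"
  proof -
    have "\<forall>\<^sub>F h::real in at_right 0. 0 < h \<and> h < 1"
      unfolding eventually_at_right_field by (intro exI[of _ 1]) auto
    with K_eventually_nonzero[OF assms(1)] show ?thesis
    proof eventually_elim
      case (elim h)
      then have "2 * of_real (K m h) * poly (reduced_P m h) w = poly (char_poly m h) w * S h"
        unfolding w_def S_def using assms(1) x by (intro reduced_P_eq_geom_exp_average) auto
      then have r: "poly (reduced_P m h) w = poly (char_poly m h) w * (S h / (2 * of_real (K m h)))"
        using elim by (simp add: field_simps)
      have p: "poly (P_poly m h) (of_real x) = of_real x ^ (m - 1) * poly (reduced_P m h) w"
        using P_poly_joukowski[OF assms(1), of "of_real x" h] x by (simp add: w_def)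
      have a: "(S h / of_real h ^ N) / (2 * of_real (K m h) / of_real h ^ N) = S h / (2 * of_real (K m h))"
        using elim by simp
      show ?case unfolding p r a ..
    qed
  qed
  then show ?thesis using lim unfolding N_def[symmetric] by (simp add: tendsto_cong)
qed

lemma P_poly_real:
  "poly (P_poly m h) (of_real x) \<in> \<real>"
proof -
  have "poly (quartic m h k) (of_real x) \<in> \<real>" for k
    unfolding quartic_def by (simp del: of_real_mult of_real_add)
  then show ?thesis
    unfolding P_poly_def B_poly_def poly_smult poly_add poly_mult poly_sum poly_prod
    by (intro Reals_mult Reals_add sum_in_Reals prod_in_Reals) simp_all
qed

lemma sign_change_root:
  fixes f :: "real \<Rightarrow> real"
  assumes "a < b" and "continuous_on UNIV f" and "f a * f b < 0"
  shows "\<exists>x. a < x \<and> x < b \<and> f x = 0"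
proof -
  have cont: "continuous_on {a..b} f" using assms(2) continuous_on_subset by blast
  have "\<exists>x. a \<le> x \<and> x \<le> b \<and> f x = 0"
  proof (cases "f a < 0")
    case True
    then have "f a \<le> 0" "0 \<le> f b" using assms(3) by (auto simp: mult_less_0_iff)
    then show ?thesis using IVT'[of f a 0 b] assms(1) cont by auto
  next
    case False
    then have "f b \<le> 0" "0 \<le> f a" using assms(3) by (auto simp: mult_less_0_iff)
    then show ?thesis using IVT2'[of f b 0 a] assms(1) cont by auto
  qed
  then obtain x where "a \<le> x" "x \<le> b" "f x = 0" by blast
  moreover have "x \<noteq> a" "x \<noteq> b" using assms(3) \<open>f x = 0\<close> by auto
  ultimately show ?thesis by force
qed

lemma distinct_roots_between_sign_changes:
  fixes f :: "real \<Rightarrow> real" and y :: "nat \<Rightarrow> real"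
  assumes "continuous_on UNIV f"
    and dec: "\<And>i. Suc i < n \<Longrightarrow> y (Suc i) < y i"
    and alt: "\<And>i. i < n \<Longrightarrow> 0 < (- 1) ^ i * f (y i)"
  shows "\<exists>X. finite X \<and> card X = n - 1 \<and> (\<forall>x\<in>X. y (n - 1) < x \<and> x < y 0 \<and> f x = 0)"
proof -
  have "\<exists>x. y (Suc i) < x \<and> x < y i \<and> f x = 0" if i: "Suc i < n" for i
  proof (rule sign_change_root[OF dec[OF i] assms(1)])
    have "0 < (- 1) ^ i * f (y i)" using alt i by simp
    with alt[OF i] have "0 < ((- 1) ^ Suc i * f (y (Suc i))) * ((- 1) ^ i * f (y i))"
      by (rule mult_pos_pos)
    also have "((- 1) ^ Suc i * f (y (Suc i))) * ((- 1) ^ i * f (y i))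
        = - (f (y (Suc i)) * f (y i)) * ((- 1) ^ i * (- 1) ^ i)"
      by (simp add: algebra_simps)
    also have "(- 1 :: real) ^ i * (- 1) ^ i = 1" by (simp flip: power_mult_distrib)
    finally show "f (y (Suc i)) * f (y i) < 0" by simp
  qed
  then obtain \<rho> where \<rho>: "\<And>i. Suc i < n \<Longrightarrow> y (Suc i) < \<rho> i \<and> \<rho> i < y i \<and> f (\<rho> i) = 0"
    by metis
  have mono: "y j \<le> y i" if "i \<le> j" "j < n" for i j
    using that
  proof (induction j rule: dec_induct)
    case (step j)
    then have "y j \<le> y i" "y (Suc j) < y j" using dec[of j] by auto
    then show ?case by linarith
  qed simp
  have less: "\<rho> j < \<rho> i" if "i < j" "Suc j < n" for i j
    using \<rho>[of i] \<rho>[of j] mono[of "Suc i" j] that by auto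
  have inj: "inj_on \<rho> {..<n - 1}"
  proof (rule inj_onI)
    fix i j assume "i \<in> {..<n - 1}" "j \<in> {..<n - 1}" and eq: "\<rho> i = \<rho> j"
    then have "Suc i < n" "Suc j < n" by auto
    then show "i = j" using eq less[of i j] less[of j i] by (cases i j rule: linorder_cases) auto
  qed
  have "\<forall>x\<in>\<rho> ` {..<n - 1}. y (n - 1) < x \<and> x < y 0 \<and> f x = 0"
  proof
    fix x assume "x \<in> \<rho> ` {..<n - 1}"
    then obtain i where "i < n - 1" and x: "x = \<rho> i" by auto
    then have i: "Suc i < n" by simp
    then show "y (n - 1) < x \<and> x < y 0 \<and> f x = 0"
      using \<rho>[of i] mono[of "Suc i" "n - 1"] mono[of 0 i] i x \<open>i < n - 1\<close> by auto
  qed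
  moreover have "card (\<rho> ` {..<n - 1}) = n - 1" using card_image[OF inj] by simp
  ultimately show ?thesis by (intro exI[of _ "\<rho> ` {..<n - 1}"]) simp
qed

text \<open>
  The \<open>m\<close> alternating points of the limit are fixed before \<open>h\<close> is, so for small \<open>h\<close> the signs of
  \<open>P_poly\<close> at these points alternate too, and the leftmost of them bounds all roots found
  away from \<open>-1\<close> uniformly in \<open>h\<close>.
\<close>

lemma P_poly_inner_real_roots:
  assumes "odd m"
  shows "\<forall>\<^sub>F h in at_right 0. \<exists>X. finite X \<and> card X = m - 1 \<and>
     (\<forall>x\<in>X. x < 0 \<and> exp h * \<bar>x\<bar> < 1 \<and> poly (P_poly m h) (of_real x) = 0)"
proof -
  have m: "m > 0" using assms by (rule odd_pos)
  define L where "L = poly (logistic_poly (2 * m - 1))"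
  obtain t where t: "alternates m L t"
  proof -
    have "Suc (m - 1) = m" "Suc (2 * (m - 1)) = 2 * m - 1" using m by auto
    with logistic_poly_alternates[of "m - 1"] show thesis using that unfolding L_def by auto
  qed
  define v where "v = (\<lambda>i. t (Suc i))"
  define y where "y = (\<lambda>i. v i / (1 + v i))"
  have v: "- 1 / 2 < v i \<and> v i < 0 \<and> 0 < (- 1) ^ Suc i * L (v i)" if "i < m" for i
  proof -
    have "t i \<le> 0" using alternates_range[OF t, of i] that by simp
    moreover have "t (Suc i) < t i" "- 1 / 2 < t (Suc i)" "0 < (- 1) ^ Suc i * L (t (Suc i))"
      using t that unfolding alternates_def by blast+
    ultimately show ?thesis unfolding v_def by linarith
  qed
  have vdec: "v (Suc i) < v i" if "Suc i < m" for i
    using t that unfolding alternates_def v_def by blast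
  have y: "- 1 < y i \<and> y i < 0" if "i < m" for i
    using v[OF that] by (auto simp: y_def field_simps)
  have ydec: "y (Suc i) < y i" if "Suc i < m" for i
  proof -
    have "y j = 1 - 1 / (1 + v j)" if "j < m" for j using v[OF that] by (simp add: y_def field_simps)
    moreover have "1 / (1 + v i) < 1 / (1 + v (Suc i))"
      using v[of i] v[of "Suc i"] vdec[OF that] that by (intro divide_strict_left_mono) auto
    ultimately show ?thesis using that by simp
  qed
  define c where "c = (\<lambda>i. y i ^ (m - 1) * (y i + 1 / y i - 2) ^ m * L (v i))"
  have c: "0 < (- 1) ^ i * c i" if "i < m" for i
  proof -
    have "0 < y i ^ (m - 1)" using y[OF that] assms by (simp add: zero_less_power_eq)
    moreover have "(y i + 1 / y i - 2) ^ m < 0"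
    proof -
      have "1 / y i < 0" using y[OF that] by simp
      then have "y i + 1 / y i - 2 < 0" using y[OF that] by linarith
      then show ?thesis using assms by (simp add: power_less_zero_eq)
    qed
    ultimately have "y i ^ (m - 1) * (y i + 1 / y i - 2) ^ m < 0" by (rule mult_pos_neg)
    moreover have "(- 1) ^ i * L (v i) < 0" using v[OF that] by simp
    ultimately have "0 < (y i ^ (m - 1) * (y i + 1 / y i - 2) ^ m) * ((- 1) ^ i * L (v i))"
      by (rule mult_neg_neg)
    then show ?thesis by (simp add: c_def mult_ac)
  qed
  have signs: "\<forall>\<^sub>F h in at_right 0. \<forall>i\<in>{..<m}. 0 < (- 1) ^ i * Re (poly (P_poly m h) (of_real (y i)))"
  proof (rule eventually_ball_finite)
    show "\<forall>i\<in>{..<m}. \<forall>\<^sub>F h in at_right 0. 0 < (- 1) ^ i * Re (poly (P_poly m h) (of_real (y i)))"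
    proof
      fix i assume "i \<in> {..<m}"
      then have i: "i < m" by simp
      have "((\<lambda>h. poly (P_poly m h) (of_real (y i))) \<longlongrightarrow> of_real (c i)) (at_right 0)"
        unfolding c_def L_def y_def using v[OF i] by (intro P_poly_limit assms) auto
      then have "((\<lambda>h. (- 1) ^ i * Re (poly (P_poly m h) (of_real (y i)))) \<longlongrightarrow>
          (- 1) ^ i * Re (of_real (c i))) (at_right 0)"
        by (intro tendsto_intros)
      then show "\<forall>\<^sub>F h in at_right 0. 0 < (- 1) ^ i * Re (poly (P_poly m h) (of_real (y i)))"
        using c[OF i] by (intro order_tendstoD(1)[where y = "(- 1) ^ i * Re (of_real (c i))"]) auto
    qed
  qed simp
  have "\<forall>\<^sub>F h in at_right 0. exp h * \<bar>y (m - 1)\<bar> < 1"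
  proof (rule order_tendstoD(2))
    show "((\<lambda>h. exp h * \<bar>y (m - 1)\<bar>) \<longlongrightarrow> exp 0 * \<bar>y (m - 1)\<bar>) (at_right 0)"
      by (intro tendsto_intros)
    show "exp 0 * \<bar>y (m - 1)\<bar> < 1" using y[of "m - 1"] m by simp
  qed
  with signs show ?thesis
  proof eventually_elim
    case (elim h)
    define f where "f = (\<lambda>x. Re (poly (P_poly m h) (of_real x)))"
    have "continuous_on UNIV f" unfolding f_def by (intro continuous_intros)
    from distinct_roots_between_sign_changes[of f m y, OF this ydec]
    obtain X where X: "finite X" "card X = m - 1" "\<And>x. x \<in> X \<Longrightarrow> y (m - 1) < x \<and> x < y 0 \<and> f x = 0"
      using elim unfolding f_def by auto
    have "x < 0 \<and> exp h * \<bar>x\<bar> < 1 \<and> poly (P_poly m h) (of_real x) = 0" if "x \<in> X" for x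
    proof (intro conjI)
      show x: "x < 0" using X(3)[OF that] y[of 0] m by linarith
      have "\<bar>x\<bar> \<le> \<bar>y (m - 1)\<bar>" using X(3)[OF that] x by linarith
      then have "exp h * \<bar>x\<bar> \<le> exp h * \<bar>y (m - 1)\<bar>" by simp
      then show "exp h * \<bar>x\<bar> < 1" using elim by linarith
      show "poly (P_poly m h) (of_real x) = 0"
        using X(3)[OF that] P_poly_real[of m h x] unfolding f_def by (auto elim!: Reals_cases)
    qed
    then show ?case using X(1,2) by blast
  qed
qed

section \<open>Inversion of the kernel\<close>

lemma coeff_reduced_P:
  assumes "odd m" and "K m h \<noteq> 0"
  shows "degree (reduced_P m h) \<le> m - 1" and "coeff (reduced_P m h) (m - 1) = 1"
    and "coeff (pCons 0 (reduced_P m h)) (m - 1) = of_real (K1 m h / K m h)"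
proof -
  define R where "R = (\<lambda>n. \<Prod>i\<in>{..<m} - {n}. [:- node m h i, 1:])"
  have R: "degree (R n) = m - 1" "coeff (R n) (m - 1) = 1"
      "coeff (pCons 0 (R n)) (m - 1) = - (\<Sum>i\<in>{..<m} - {n}. node m h i)" if "n < m" for n
    using coeff_prod_linear[of "{..<m} - {n}" "node m h"] that by (simp_all add: R_def)
  have P: "reduced_P m h = smult (1 / of_real (K m h)) (\<Sum>n<m. smult (weight m h n) (R n))"
    by (simp add: reduced_P_def R_def)
  have "degree (\<Sum>n<m. smult (weight m h n) (R n)) \<le> m - 1"
    using R(1) by (intro degree_sum_le) auto
  then show "degree (reduced_P m h) \<le> m - 1" unfolding P by simp
  show "coeff (reduced_P m h) (m - 1) = 1"
  proof -
    have "coeff (\<Sum>n<m. smult (weight m h n) (R n)) (m - 1) = of_real (K m h)"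
      using R(2) by (simp add: coeff_sum K_eq_weight_sum[OF assms(1)])
    then show ?thesis unfolding P using assms(2) by simp
  qed
  have "coeff (pCons 0 (reduced_P m h)) (m - 1)
      = 1 / of_real (K m h) * (\<Sum>n<m. weight m h n * coeff (pCons 0 (R n)) (m - 1))"
    unfolding P by (cases "m - 1") (simp_all add: coeff_sum)
  then have "coeff (pCons 0 (reduced_P m h)) (m - 1)
      = 1 / of_real (K m h) * (\<Sum>n<m. weight m h n * - (\<Sum>i\<in>{..<m} - {n}. node m h i))"
    using R(3) by simp
  then show "coeff (pCons 0 (reduced_P m h)) (m - 1) = of_real (K1 m h / K m h)"
    unfolding of_real_divide K1_eq_weight_node_sum[OF assms(1)] by (simp add: sum_negf)
qed

lemma coeff_char_poly:
  assumes "odd m"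
  shows "degree (char_poly m h) = m" and "coeff (char_poly m h) m = 1"
    and "coeff (char_poly m h) (m - 1) = of_real (M1 m h)"
proof -
  note c = coeff_prod_linear[of "{..<m}" "node m h", folded char_poly_def, simplified]
  show "degree (char_poly m h) = m" "coeff (char_poly m h) m = 1" using c by simp_all
  have "coeff (pCons 0 (char_poly m h)) m = coeff (char_poly m h) (m - 1)"
    using odd_pos[OF assms] by (cases m) auto
  then show "coeff (char_poly m h) (m - 1) = of_real (M1 m h)"
    using c(3) unfolding M1_eq_node_sum[OF assms] by simp
qed

lemma inj_on_joukowski: "inj_on (\<lambda>z::complex. z + 1 / z) {z. z \<noteq> 0 \<and> norm z < 1}"
proof (rule inj_onI)
  fix a b :: complex
  assume a: "a \<in> {z. z \<noteq> 0 \<and> norm z < 1}" and b: "b \<in> {z. z \<noteq> 0 \<and> norm z < 1}"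
    and eq: "a + 1 / a = b + 1 / b"
  have "norm a * norm b < 1 * 1" using a b by (intro mult_strict_mono) auto
  then have "1 - a * b \<noteq> 0" by (metis eq_iff_diff_eq_0 less_irrefl norm_mult norm_one mult_1)
  moreover have "(a - b) * (1 - a * b) = a * b * (b + 1 / b) - a * b * (a + 1 / a)"
    using a b by (simp add: algebra_simps)
  ultimately show "a = b" using eq by simp
qed

text \<open>
  Inside the punctured unit disc \<open>z \<mapsto> z + 1/z\<close> is injective, so \<open>m - 1\<close> roots of \<open>P_poly\<close> there give
  \<open>m - 1\<close> roots of the monic polynomial \<open>reduced_P\<close>, which has no others.
\<close>

lemma reduced_P_factorization:
  assumes "odd m" and "K m h \<noteq> 0" and "finite Z" and "card Z = m - 1"
    and Z: "\<And>z. z \<in> Z \<Longrightarrow> z \<noteq> 0 \<and> norm z < 1 \<and> poly (P_poly m h) z = 0"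
  shows "reduced_P m h = (\<Prod>w\<in>(\<lambda>z. z + 1 / z) ` Z. [:- w, 1:])"
proof -
  define W where "W = (\<lambda>z. z + 1 / z) ` Z"
  have "inj_on (\<lambda>z. z + 1 / z) Z"
    using inj_on_joukowski by (rule inj_on_subset) (use Z in auto)
  then have W: "finite W" "card W = m - 1" using assms(3,4) by (simp_all add: W_def card_image)
  note c = coeff_prod_linear[OF W(1), of "\<lambda>w. w", unfolded W(2)]
  show ?thesis
    unfolding W_def[symmetric]
  proof (rule poly_eqI_degree_lead_coeff[where n = "m - 1" and A = W])
    fix w assume "w \<in> W"
    then obtain z where z: "z \<in> Z" "w = z + 1 / z" by (auto simp: W_def)
    then have "poly (reduced_P m h) w = 0"
      using P_poly_joukowski[OF assms(1), of z h] Z[OF z(1)] by simp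
    moreover have "poly (\<Prod>w\<in>W. [:- w, 1:]) w = 0"
      using \<open>w \<in> W\<close> W(1) unfolding poly_prod by (intro prod_zero) auto
    ultimately show "poly (reduced_P m h) w = poly (\<Prod>w\<in>W. [:- w, 1:]) w" by simp
  qed (use c W coeff_reduced_P[OF assms(1,2)] in auto)
qed

lemma inner_roots_eq:
  assumes "odd m" and "K m h \<noteq> 0" and "finite Z" and "card Z = m - 1"
    and Z: "\<And>z. z \<in> Z \<Longrightarrow> z \<noteq> 0 \<and> norm z < 1 \<and> poly (P_poly m h) z = 0"
  shows "{z. poly (P_poly m h) z = 0 \<and> norm z < 1} = Z"
proof (intro equalityI subsetI)
  fix z assume "z \<in> {z. poly (P_poly m h) z = 0 \<and> norm z < 1}"
  then have z: "poly (P_poly m h) z = 0" "norm z < 1" by auto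
  have "z \<noteq> 0" using z poly_P_poly_0[OF assms(2)] by auto
  then have "poly (reduced_P m h) (z + 1 / z) = 0"
    using z P_poly_joukowski[OF assms(1), of z h] by simp
  then have "\<exists>w\<in>(\<lambda>z. z + 1 / z) ` Z. poly [:- w, 1:] (z + 1 / z) = 0"
    by (simp only: reduced_P_factorization[OF assms] poly_prod prod_zero_iff[OF finite_imageI[OF assms(3)]])
  then obtain w where "w \<in> (\<lambda>z. z + 1 / z) ` Z" "poly [:- w, 1:] (z + 1 / z) = 0" ..
  then obtain y where y: "y \<in> Z" "z + 1 / z = y + 1 / y" by auto
  then have "z = y" using inj_on_joukowski Z[OF y(1)] z \<open>z \<noteq> 0\<close> by (auto dest: inj_onD)
  then show "z \<in> Z" using y by simp
qed (use Z in auto)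

lemma pderiv_P_poly_joukowski:
  assumes "odd m" and "z \<noteq> 0" and "poly (reduced_P m h) (z + 1 / z) = 0"
  shows "poly (pderiv (P_poly m h)) z
    = z ^ (m - 1) * (poly (pderiv (reduced_P m h)) (z + 1 / z) * (1 - 1 / z\<^sup>2))"
proof -
  have "((\<lambda>z. poly (reduced_P m h) (z + 1 / z)) has_field_derivative
      poly (pderiv (reduced_P m h)) (z + 1 / z) * (1 - 1 / z\<^sup>2)) (at z)"
    by (rule DERIV_chain2[OF poly_DERIV])
      (use assms(2) in \<open>auto intro!: derivative_eq_intros simp: power2_eq_square\<close>)
  moreover have "((\<lambda>z. z ^ (m - 1)) has_field_derivative of_nat (m - 1) * z ^ (m - 1 - 1)) (at z)"
    by (auto intro!: derivative_eq_intros)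
  ultimately
  have "((\<lambda>z. z ^ (m - 1) * poly (reduced_P m h) (z + 1 / z)) has_field_derivative
      z ^ (m - 1) * (poly (pderiv (reduced_P m h)) (z + 1 / z) * (1 - 1 / z\<^sup>2))) (at z)"
    using assms(3) DERIV_mult by (fastforce simp: mult.commute)
  then have "(poly (P_poly m h) has_field_derivative
      z ^ (m - 1) * (poly (pderiv (reduced_P m h)) (z + 1 / z) * (1 - 1 / z\<^sup>2))) (at z)"
  proof (rule has_field_derivative_transform_within_open[where S = "- {0}"])
    show "z ^ (m - 1) * poly (reduced_P m h) (z + 1 / z) = poly (P_poly m h) z" if "z \<in> - {0}" for z
      using P_poly_joukowski[OF assms(1), of z h] that by simp
  qed (use assms(2) in auto)
  then show ?thesis using DERIV_unique poly_DERIV by blast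
qed

text \<open>
  The left-hand side is the coefficient of \<open>1 / (z + 1/z - w)\<close> in the generating function of
  \<open>A/z \<cdot> z\<^bsup>\<bar>\<beta>\<bar>\<^esup>\<close>; the sign accounts for the reversed difference \<open>w - (z + 1/z)\<close> in \<open>partial_fractions\<close>.
\<close>

lemma A_coeff_eq_residue:
  assumes "odd m" and "z \<noteq> 0" and "poly (reduced_P m h) (z + 1 / z) = 0" and "z\<^sup>2 \<noteq> 1"
  shows "A_coeff m h z / z * (1 / z - z)
    = - (poly (char_poly m h) (z + 1 / z) / poly (pderiv (reduced_P m h)) (z + 1 / z))"
proof -
  define q where "q = poly (char_poly m h) (z + 1 / z)"
  define r where "r = poly (pderiv (reduced_P m h)) (z + 1 / z)"
  have zm: "z ^ m = z * z ^ (m - 1)" using odd_pos[OF assms(1)] by (cases m) auto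
  have "A_coeff m h z = z ^ m * q / (z * (z ^ (m - 1) * (r * (1 - 1 / z\<^sup>2))))"
    unfolding A_coeff_def char_poly_joukowski[OF assms(1,2)] pderiv_P_poly_joukowski[OF assms(1-3)]
      q_def r_def ..
  also have "\<dots> = q / (r * (1 - 1 / z\<^sup>2))" unfolding zm using assms(2) by simp
  finally have A: "A_coeff m h z = q / (r * (1 - 1 / z\<^sup>2))" .
  have "1 / z * (1 / z - z) = - (1 - 1 / z\<^sup>2)"
    using assms(2) by (simp add: field_simps power2_eq_square)
  moreover have "1 - 1 / z\<^sup>2 \<noteq> 0" using assms(2,4) by (simp add: field_simps)
  moreover have "q / (r * d) * - d = - (q / r)" if "d \<noteq> 0" for d using that by simp
  ultimately have "q / (r * (1 - 1 / z\<^sup>2)) * (1 / z * (1 / z - z)) = - (q / r)"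
    by (simp only:)
  then show ?thesis
    unfolding A q_def[symmetric] r_def[symmetric] by simp
qed

lemma norm_exp_unity_root:
  assumes "h > 0"
  shows "norm (exp (of_real h * unity_root m n)) \<le> exp h"
    and "norm (1 / exp (of_real h * unity_root m n)) \<le> exp h"
proof -
  have "\<bar>Re (unity_root m n)\<bar> \<le> 1" by (simp add: unity_root_def)
  then have "\<bar>h * Re (unity_root m n)\<bar> \<le> h" using assms by (simp add: abs_mult)
  then show "norm (exp (of_real h * unity_root m n)) \<le> exp h"
    and "norm (1 / exp (of_real h * unity_root m n)) \<le> exp h"
    by (auto simp: norm_divide divide_inverse simp flip: exp_minus)
qed

text \<open>
  With \<open>B = A/z\<close> the three cases in the definition of \<open>D_grid\<close> merge into a tridiagonal part plus
  \<open>\<Sum>z. B z\<^bsup>\<bar>\<beta>\<bar>\<^esup>\<close>, the shape required by \<open>exponential_convolution_inverse\<close>.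
\<close>

lemma discrete_analogue_of_inner_roots:
  assumes m: "odd m" and h: "h > 0" and K: "K m h \<noteq> 0"
    and Z: "finite Z" "card Z = m - 1"
      "\<And>z. z \<in> Z \<Longrightarrow> z \<noteq> 0 \<and> exp h * norm z < 1 \<and> poly (P_poly m h) z = 0"
    and lam: "bij_betw lam {1..m - 1} Z"
  shows "is_discrete_analogue m h (D_grid m h lam)"
proof -
  define u where "u = (\<lambda>n. exp (of_real h * unity_root m n))"
  define W where "W = (\<lambda>z. z + 1 / z) ` Z"
  define c where "c = complex_of_real (M1 m h - K1 m h / K m h)"
  define B where "B = (\<lambda>z. A_coeff m h z / z)"
  define \<omega> where "\<omega> = (\<lambda>n. unity_root m n / (4 * of_real (K m h)))"
  have unit: "norm z < 1" if "z \<in> Z" for z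
  proof -
    have "norm z \<le> exp h * norm z" using h by (simp add: mult_le_cancel_right1)
    then show ?thesis using Z(3)[OF that] by linarith
  qed
  have roots: "z \<noteq> 0 \<and> norm z < 1 \<and> poly (P_poly m h) z = 0" if "z \<in> Z" for z
    using Z(3) unit that by blast
  have inj: "inj_on (\<lambda>z. z + 1 / z) Z"
    using inj_on_joukowski by (rule inj_on_subset) (use roots in auto)
  have W: "finite W" "card W = m - 1" using Z(1,2) inj by (simp_all add: W_def card_image)
  have P: "reduced_P m h = (\<Prod>w\<in>W. [:- w, 1:])"
    unfolding W_def by (rule reduced_P_factorization[OF m K Z(1,2) roots])
  have Pw: "poly (reduced_P m h) w = 0" if "w \<in> W" for w
    using that W(1) unfolding P poly_prod by (intro prod_zero) auto
  have u: "u n \<noteq> 0" "u n + 1 / u n = node m h n" "u n - 1 / u n = 2 * sinh (of_real h * unity_root m n)" for n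
    by (simp_all add: u_def node_def cosh_field_def sinh_field_def exp_minus inverse_eq_divide)
  have small: "norm (z * u n) < 1 \<and> norm (z / u n) < 1" if "z \<in> Z" for z n
  proof -
    have e: "norm z * exp h < 1" using Z(3)[OF that] by (simp add: mult.commute)
    have "norm (z * u n) = norm z * norm (u n)" "norm (z / u n) = norm z * norm (1 / u n)"
      by (simp_all add: norm_mult norm_divide)
    moreover have "norm z * norm (u n) \<le> norm z * exp h" "norm z * norm (1 / u n) \<le> norm z * exp h"
      unfolding u_def using norm_exp_unity_root[OF h] by (intro mult_left_mono; simp)+
    ultimately show ?thesis using e by linarith
  qed
  have node: "z + 1 / z \<noteq> node m h n" if "z \<in> Z" for z n
  proof
    assume "z + 1 / z = node m h n"
    then have "z + 1 / z = u n + 1 / u n" using u(2) by simp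
    moreover have "z * u n * (z + 1 / z - (u n + 1 / u n)) = (z - u n) * (z * u n - 1)"
      using roots[OF that] u(1)[of n] by (simp add: field_simps)
    ultimately have "z = u n \<or> z * u n = 1" by simp
    then show False using small[OF that, of n] u(1)[of n] by auto
  qed
  have q_node: "poly (char_poly m h) (node m h n) = 0" if "n < m" for n
    unfolding char_poly_def poly_prod by (rule prod_zero) (use that in auto)
  have d: "((\<lambda>\<gamma>. ((if \<gamma> = 0 then c else if \<bar>\<gamma>\<bar> = 1 then 1 else 0) + (\<Sum>z\<in>Z. B z * z ^ nat \<bar>\<gamma>\<bar>)) *
      (\<Sum>n<m. \<omega> n * (u n ^ nat \<bar>\<beta> - \<gamma>\<bar> - (1 / u n) ^ nat \<bar>\<beta> - \<gamma>\<bar>)))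
      has_sum (if \<beta> = 0 then 1 else 0)) UNIV" for \<beta> :: int
  proof (rule exponential_convolution_inverse[OF Z(1) _ small])
    show "0 \<notin> Z" using roots by auto
    show "u n \<noteq> 0" for n by (rule u(1))
    show "2 * (\<Sum>n<m. \<omega> n * (u n - 1 / u n)) = 1"
    proof -
      have "2 * (\<Sum>n<m. \<omega> n * (u n - 1 / u n)) = (\<Sum>n<m. weight m h n) / of_real (K m h)"
        unfolding u(3) by (simp add: \<omega>_def weight_def sum_distrib_left sum_divide_distrib)
      then show ?thesis using K by (simp flip: K_eq_weight_sum[OF m])
    qed
    show "(\<Sum>n<m. \<omega> n * ((u n - 1 / u n) / (z + 1 / z - (u n + 1 / u n)))) = 0" if z: "z \<in> Z" for z
    proof -
      have w: "poly (reduced_P m h) (z + 1 / z) = 0" using Pw z by (simp add: W_def)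
      have "poly (char_poly m h) (z + 1 / z) \<noteq> 0"
        unfolding char_poly_def poly_prod using node[OF z] by simp
      then have "(\<Sum>n<m. weight m h n / (z + 1 / z - node m h n)) = 0"
        using poly_reduced_P_weights[OF K, of "z + 1 / z"] node[OF z] w by simp
      moreover have "(\<Sum>n<m. \<omega> n * ((u n - 1 / u n) / (z + 1 / z - (u n + 1 / u n))))
         = (\<Sum>n<m. weight m h n / (z + 1 / z - node m h n)) / (2 * of_real (K m h))"
        unfolding u(2,3) sum_divide_distrib by (simp add: \<omega>_def weight_def mult_ac)
      ultimately show ?thesis by simp
    qed
    show "u n + 1 / u n + c + (\<Sum>z\<in>Z. B z * ((1 / z - z) / (z + 1 / z - (u n + 1 / u n)))) = 0"
      if "n \<in> {..<m}" for n
    proof -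
      have n: "n < m" using that by simp
      have notW: "node m h n \<notin> W"
      proof
        assume "node m h n \<in> W"
        then obtain z where "z \<in> Z" "node m h n = z + 1 / z" unfolding W_def by (rule imageE)
        then show False using node[of z n] by simp
      qed
      have Sm: "Suc (card W) = m" using W(2) odd_pos[OF m] by simp
      have "poly (char_poly m h) (node m h n) / poly (reduced_P m h) (node m h n)
        = node m h n + c + (\<Sum>w\<in>W. poly (char_poly m h) w /
            (poly (pderiv (reduced_P m h)) w * (node m h n - w)))"
        unfolding P
      proof (rule partial_fractions[OF W(1)])
        show "coeff (char_poly m h) (card W) = coeff (pCons 0 (\<Prod>w\<in>W. [:- w, 1:])) (card W) + c"
          using coeff_char_poly(3)[OF m, of h] coeff_reduced_P(3)[OF m K]
          unfolding P[symmetric] W(2) c_def by simp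
      qed (use coeff_char_poly[OF m, of h] notW in \<open>simp_all only: Sm order_refl not_False_eq_True\<close>)
      then have "node m h n + c + (\<Sum>w\<in>W. poly (char_poly m h) w /
            (poly (pderiv (reduced_P m h)) w * (node m h n - w))) = 0"
        using q_node[OF n] by simp
      also have "(\<Sum>w\<in>W. poly (char_poly m h) w / (poly (pderiv (reduced_P m h)) w * (node m h n - w)))
         = (\<Sum>z\<in>Z. B z * ((1 / z - z) / (z + 1 / z - (u n + 1 / u n))))"
        unfolding W_def sum.reindex[OF inj] o_def u(2)
      proof (rule sum.cong[OF refl])
        fix z assume z: "z \<in> Z"
        have "z\<^sup>2 \<noteq> 1"
        proof
          assume "z\<^sup>2 = 1"
          then have "norm z ^ 2 = 1" by (metis norm_power norm_one)
          then have "norm z = 1 \<or> norm z = - 1" by (simp only: power2_eq_1_iff)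
          then show False using unit[OF z] norm_ge_zero[of z] by linarith
        qed
        then have "B z * (1 / z - z) = - (poly (char_poly m h) (z + 1 / z)
            / poly (pderiv (reduced_P m h)) (z + 1 / z))"
          unfolding B_def using roots[OF z] Pw z by (intro A_coeff_eq_residue m) (auto simp: W_def)
        then have "B z * ((1 / z - z) / (z + 1 / z - node m h n)) = - (poly (char_poly m h) (z + 1 / z)
            / poly (pderiv (reduced_P m h)) (z + 1 / z)) / (z + 1 / z - node m h n)"
          by simp
        also have "\<dots> = poly (char_poly m h) (z + 1 / z)
            / (poly (pderiv (reduced_P m h)) (z + 1 / z) * (node m h n - (z + 1 / z)))"
          by (metis divide_divide_eq_left minus_diff_eq minus_divide_divide minus_divide_left)
        finally show "poly (char_poly m h) (z + 1 / z)
            / (poly (pderiv (reduced_P m h)) (z + 1 / z) * (node m h n - (z + 1 / z)))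
          = B z * ((1 / z - z) / (z + 1 / z - node m h n))" ..
      qed
      finally show ?thesis unfolding u(2) .
    qed
  qed simp
  have sumZ: "(\<Sum>n=1..m - 1. f (lam n)) = (\<Sum>z\<in>Z. f z)" for f :: "complex \<Rightarrow> complex"
    using sum.reindex_bij_betw[OF lam] by simp
  have D: "D_grid m h lam \<gamma> = of_real (real m / K m h) *
      ((if \<gamma> = 0 then c else if \<bar>\<gamma>\<bar> = 1 then 1 else 0) + (\<Sum>z\<in>Z. B z * z ^ nat \<bar>\<gamma>\<bar>))" for \<gamma>
  proof -
    have pow: "B z * z ^ nat \<bar>\<gamma>\<bar> = A_coeff m h z * z ^ (nat \<bar>\<gamma>\<bar> - 1)" if "z \<in> Z" "\<gamma> \<noteq> 0" for z
    proof -
      obtain k where "nat \<bar>\<gamma>\<bar> = Suc k" using \<open>\<gamma> \<noteq> 0\<close> by (cases "nat \<bar>\<gamma>\<bar>") auto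
      then show ?thesis using roots[OF that(1)] by (simp add: B_def)
    qed
    show ?thesis
    proof (cases "\<gamma> = 0")
      case True
      then show ?thesis
        unfolding D_grid_def sumZ[of "\<lambda>z. A_coeff m h z / z"] by (simp add: B_def c_def)
    next
      case False
      then have "(\<Sum>z\<in>Z. B z * z ^ nat \<bar>\<gamma>\<bar>) = (\<Sum>z\<in>Z. A_coeff m h z * z ^ (nat \<bar>\<gamma>\<bar> - 1))"
        using pow by (intro sum.cong) auto
      then show ?thesis
        unfolding D_grid_def sumZ[of "A_coeff m h"] sumZ[of "\<lambda>z. A_coeff m h z * z ^ (nat \<bar>\<gamma>\<bar> - 1)"]
        using False by simp
    qed
  qed
  have G: "of_real (real m / K m h) * G_grid m h \<gamma>
      = (\<Sum>n<m. \<omega> n * (u n ^ nat \<bar>\<gamma>\<bar> - (1 / u n) ^ nat \<bar>\<gamma>\<bar>))" for \<gamma>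
    unfolding G_grid_eq_exp_sum[OF odd_pos[OF m] h] u_def \<omega>_def sum_distrib_left
    using odd_pos[OF m] by (intro sum.cong refl) simp
  have "((\<lambda>\<gamma>. D_grid m h lam \<gamma> * G_grid m h (\<beta> - \<gamma>)) has_sum discrete_delta \<beta>) UNIV" for \<beta>
  proof -
    have "D_grid m h lam \<gamma> * G_grid m h (\<beta> - \<gamma>)
      = ((if \<gamma> = 0 then c else if \<bar>\<gamma>\<bar> = 1 then 1 else 0) + (\<Sum>z\<in>Z. B z * z ^ nat \<bar>\<gamma>\<bar>)) *
      (\<Sum>n<m. \<omega> n * (u n ^ nat \<bar>\<beta> - \<gamma>\<bar> - (1 / u n) ^ nat \<bar>\<beta> - \<gamma>\<bar>))" for \<gamma>
      unfolding D G[symmetric] by (simp only: mult_ac)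
    then show ?thesis using d[of \<beta>] unfolding discrete_delta_def by simp
  qed
  then show ?thesis
    unfolding is_discrete_analogue_def discrete_conv_def by (metis has_sum_iff)
qed

theorem theorem2:
  fixes m :: nat
  assumes "odd m"
  shows "\<exists>h0>0. \<forall>h::real. 0 < h \<and> h < h0 \<longrightarrow>
    (\<exists>lam. enumerates_inner_roots m h lam) \<and>
    (\<forall>lam. enumerates_inner_roots m h lam \<longrightarrow> is_discrete_analogue m h (D_grid m h lam))"
proof -
  have "\<forall>\<^sub>F h in at_right 0. 0 < h \<longrightarrow> (\<exists>lam. enumerates_inner_roots m h lam) \<and>
    (\<forall>lam. enumerates_inner_roots m h lam \<longrightarrow> is_discrete_analogue m h (D_grid m h lam))"
    using K_eventually_nonzero[OF assms] P_poly_inner_real_roots[OF assms]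
  proof eventually_elim
    case (elim h)
    then obtain X where X: "finite X" "card X = m - 1"
      "\<And>x. x \<in> X \<Longrightarrow> x < 0 \<and> exp h * \<bar>x\<bar> < 1 \<and> poly (P_poly m h) (of_real x) = 0" by blast
    define Z :: "complex set" where "Z = of_real ` X"
    have Z: "finite Z" "card Z = m - 1"
      using X by (simp_all add: Z_def card_image inj_on_def)
    have Z_root: "z \<noteq> 0 \<and> exp h * norm z < 1 \<and> poly (P_poly m h) z = 0" if "z \<in> Z" for z
    proof -
      obtain x where "x \<in> X" "z = of_real x" using \<open>z \<in> Z\<close> by (auto simp: Z_def)
      then show ?thesis using X(3)[of x] by auto
    qed
    show ?case
    proof (intro impI)
      assume h: "0 < h"
      have "norm z < 1" if "z \<in> Z" for z
      proof -
        have "norm z \<le> exp h * norm z" using h by (simp add: mult_le_cancel_right1)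
        then show ?thesis using Z_root[OF that] by linarith
      qed
      then have inner: "{z. poly (P_poly m h) z = 0 \<and> cmod z < 1} = Z"
        using elim Z Z_root by (intro inner_roots_eq assms) auto
      have "\<exists>lam. bij_betw lam {1..m - 1} Z"
        using Z(1,2) by (intro finite_same_card_bij) auto
      then show "(\<exists>lam. enumerates_inner_roots m h lam) \<and>
        (\<forall>lam. enumerates_inner_roots m h lam \<longrightarrow> is_discrete_analogue m h (D_grid m h lam))"
        unfolding enumerates_inner_roots_def inner
        using discrete_analogue_of_inner_roots[OF assms h _ Z Z_root] elim by blast
    qed
  qed
  then show ?thesis unfolding eventually_at_right_field by blast
qed

end
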